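(* Let $\mathcal{H}$ be a complex Hilbert space and let $T \in \mathcal{B}(\mathcal{H})$. Then for all real $\alpha \in [0,1]$ and $r \geq 1$, $$\begin{aligned} w^{4r}(T) &\leq \frac{\alpha}{8} \left\||T|^{4r} + |T^*|^{4r} \right\| + \frac{\alpha}{4}\, w\left(|T^*|^{2r} |T|^{2r}\right) + \frac{\alpha}{2}\, w^{2r}(T^2)\\ &\quad +\frac{1-\alpha}{4} \left\| |T|^{2r} + |T^*|^{2r}\right\| w^{2r}(T) + \frac{1-\alpha}{2}\,w^r(T^2)\, w^{2r}(T)\\ &\leq \frac{1}{2}\left\||T|^{4r} + |T^*|^{4r}\right\|. \end{aligned}$$
   Context: $\mathcal{B}(\mathcal{H})$ is the $C^*$-algebra of all bounded linear operators on $\mathcal{H}$; $\|\cdot\|$ is the operator norm. For $T\in\mathcal{B}(\mathcal{H})$, $|T| = (T^*T)^{1/2}$, and hence $|T^*| = (TT^* )^{1/2}$; real powers of positive operators are taken by continuous functional calculus. The numerical radius is $w(T) = \sup_{\|x\|=1} |\langle Tx, x\rangle|$, and $w^p(T)$ denotes $(w(T))^p$. *)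

theory Defs
  imports "HOL-Analysis.Analysis" "HOL-Computational_Algebra.Polynomial"
begin

text \<open>
  A complex Hilbert space: a complex inner product (linear in the first argument) on a complex
  vector space, complete for the induced norm. The real Banach space structure inherited from
  \<^class>\<open>banach\<close> is the one obtained by restriction of scalars, by \<open>scaleR_scaleC\<close> and
  \<open>norm_eq_sqrt_cinner\<close>. The zero space is a permitted instance.
\<close>

class chilbert_space = banach +
  fixes scaleC :: "complex \<Rightarrow> 'a \<Rightarrow> 'a"  (infixr \<open>*\<^sub>C\<close> 75)
    and cinner :: "'a \<Rightarrow> 'a \<Rightarrow> complex"
  assumes scaleC_add_right: "c *\<^sub>C (x + y) = c *\<^sub>C x + c *\<^sub>C y"
    and scaleC_add_left: "(c + d) *\<^sub>C x = c *\<^sub>C x + d *\<^sub>C x"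
    and scaleC_scaleC: "c *\<^sub>C (d *\<^sub>C x) = (c * d) *\<^sub>C x"
    and scaleC_one: "1 *\<^sub>C x = x"
    and scaleR_scaleC: "a *\<^sub>R x = complex_of_real a *\<^sub>C x"
    and cinner_commute: "cinner x y = cnj (cinner y x)"
    and cinner_add_left: "cinner (x + y) z = cinner x z + cinner y z"
    and cinner_scaleC_left: "cinner (c *\<^sub>C x) y = c * cinner x y"
    and cinner_ge_zero: "0 \<le> Re (cinner x x)"
    and cinner_eq_zero_iff: "cinner x x = 0 \<longleftrightarrow> x = 0"
    and norm_eq_sqrt_cinner: "norm x = sqrt (Re (cinner x x))"

text \<open>
  The bounded operators on the complex space are the complex-linear elements of
  \<open>'a \<Rightarrow>\<^sub>L 'a\<close>. The norm of \<open>'a \<Rightarrow>\<^sub>L 'a\<close> is the operator norm.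
\<close>

definition bounded_ops :: "('a::chilbert_space \<Rightarrow>\<^sub>L 'a) set" where
  "bounded_ops = {T. \<forall>c x. blinfun_apply T (c *\<^sub>C x) = c *\<^sub>C blinfun_apply T x}"

definition adj :: "('a::chilbert_space \<Rightarrow>\<^sub>L 'a) \<Rightarrow> ('a \<Rightarrow>\<^sub>L 'a)" where
  "adj T = (THE S. S \<in> bounded_ops \<and>
     (\<forall>x y. cinner (blinfun_apply T x) y = cinner x (blinfun_apply S y)))"

definition spectrum :: "('a::chilbert_space \<Rightarrow>\<^sub>L 'a) \<Rightarrow> complex set" where
  "spectrum A = {z. \<not> (\<exists>B\<in>bounded_ops.
     (\<forall>x. blinfun_apply B (blinfun_apply A x - z *\<^sub>C x) = x) \<and>
     (\<forall>x. blinfun_apply A (blinfun_apply B x) - z *\<^sub>C blinfun_apply B x = x))}"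

definition op_poly :: "real poly \<Rightarrow> ('a::chilbert_space \<Rightarrow>\<^sub>L 'a) \<Rightarrow> ('a \<Rightarrow>\<^sub>L 'a)" where
  "op_poly p A = (\<Sum>i\<le>degree p. coeff p i *\<^sub>R (((o\<^sub>L) A) ^^ i) id_blinfun)"

text \<open>
  Continuous functional calculus of a self-adjoint \<open>A\<close> at a real function \<open>f\<close> continuous on the
  spectrum: \<open>f(A)\<close> is the norm limit of \<open>p\<^sub>n(A)\<close> for polynomials \<open>p\<^sub>n\<close> converging to \<open>f\<close> uniformly
  on the spectrum. As \<open>A\<close> is self-adjoint, its spectrum consists of real numbers, so restricting
  to the real points of the spectrum loses nothing.
\<close>

definition cfc :: "(real \<Rightarrow> real) \<Rightarrow> ('a::chilbert_space \<Rightarrow>\<^sub>L 'a) \<Rightarrow> ('a \<Rightarrow>\<^sub>L 'a)" where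
  "cfc f A = (THE B. \<forall>p :: nat \<Rightarrow> real poly.
     uniform_limit {t. complex_of_real t \<in> spectrum A} (\<lambda>n. poly (p n)) f sequentially
       \<longrightarrow> (\<lambda>n. op_poly (p n) A) \<longlonglongrightarrow> B)"

text \<open>
  Intended for positive \<open>A\<close> and \<open>s > 0\<close>, where \<open>t powr s\<close> is continuous on \<open>[0, \<infinity>)\<close>
  (with \<open>0 powr s = 0\<close>).
\<close>

definition op_powr :: "('a::chilbert_space \<Rightarrow>\<^sub>L 'a) \<Rightarrow> real \<Rightarrow> ('a \<Rightarrow>\<^sub>L 'a)" where
  "op_powr A s = cfc (\<lambda>t. t powr s) A"

definition op_abs :: "('a::chilbert_space \<Rightarrow>\<^sub>L 'a) \<Rightarrow> ('a \<Rightarrow>\<^sub>L 'a)" where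
  "op_abs T = op_powr (adj T o\<^sub>L T) (1 / 2)"

text \<open>
  Inserting \<open>0\<close> only matters on the zero space, where there are no unit vectors and the supremum
  of the empty set of nonnegative numbers is taken to be \<open>0\<close>.
\<close>

definition num_radius :: "('a::chilbert_space \<Rightarrow>\<^sub>L 'a) \<Rightarrow> real" where
  "num_radius T = Sup (insert 0 {cmod (cinner (blinfun_apply T x) x) | x. norm x = 1})"

end

theory Submission
  imports Defs "HOL-Computational_Algebra.Fundamental_Theorem_Algebra"
begin

text \<open>
  For a unit vector \<open>x\<close>, Buzano's inequality bounds \<open>|\<langle>Tx,x\<rangle>|\<^sup>2\<close> by the mean of
  \<open>\<parallel>Tx\<parallel> \<parallel>T\<^sup>*x\<parallel>\<close> and \<open>|\<langle>T\<^sup>2x,x\<rangle>|\<close>. Raising this to the powers \<open>r\<close> and \<open>2r\<close> and using convexity and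
  McCarthy's inequality \<open>\<parallel>Tx\<parallel>\<^sup>2\<^sup>r \<le> \<langle>|T|\<^sup>2\<^sup>rx,x\<rangle>\<close> gives the case \<open>\<alpha> = 0\<close> of the first inequality
  (from the power \<open>r\<close>, multiplied by \<open>w(T)\<^sup>2\<^sup>r\<close>) and, after a second use of Buzano's inequality for
  \<open>|T|\<^sup>2\<^sup>rx\<close> and \<open>|T\<^sup>*|\<^sup>2\<^sup>rx\<close>, the case \<open>\<alpha> = 1\<close>; the general case is their convex combination.

  The functional calculus rests on the fact that a real polynomial \<open>p\<close> without zeros on the real
  spectrum of a self-adjoint \<open>A\<close> makes \<open>p(A)\<close> bounded below: this holds for each real linear factor,
  and \<open>(A - a)\<^sup>2 + b\<^sup>2 \<ge> b\<^sup>2\<close> for the quadratic ones. As \<open>p(A) - m\<close> is not bounded below when \<open>m\<close> is the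
  infimum of the quadratic form of \<open>p(A)\<close>, that infimum is a value of \<open>p\<close> on the spectrum.
\<close>

subsection \<open>Complex inner products\<close>

lemma scaleC_simps [simp]:
  fixes x :: "'a::chilbert_space"
  shows "c *\<^sub>C (0::'a) = 0" "0 *\<^sub>C x = 0" "1 *\<^sub>C x = x" "c *\<^sub>C (- x) = - (c *\<^sub>C x)"
proof -
  show zero: "c *\<^sub>C (0::'a) = 0" for c
    using scaleC_add_right[of c "0::'a" 0] by simp
  show "0 *\<^sub>C x = 0"
    using scaleC_add_left[of 0 0 x] by simp
  show "1 *\<^sub>C x = x"
    by (rule scaleC_one)
  show "c *\<^sub>C (- x) = - (c *\<^sub>C x)"
    using scaleC_add_right[of c x "- x"] by (simp add: zero eq_neg_iff_add_eq_0 add.commute)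
qed

lemma cinner_simps [simp]:
  fixes x y :: "'a::chilbert_space"
  shows "cinner 0 y = 0" "cinner x 0 = 0" "cinner (- x) y = - cinner x y" "cinner x (- y) = - cinner x y"
proof -
  show z: "cinner 0 y = 0" for y :: 'a
    using cinner_add_left[of 0 0 y] by simp
  show "cinner x 0 = 0"
    using cinner_commute[of x 0] z by simp
  show m: "cinner (- x) y = - cinner x y" for x y :: 'a
    using cinner_add_left[of x "- x" y] z by (simp add: eq_neg_iff_add_eq_0 add.commute)
  show "cinner x (- y) = - cinner x y"
    using cinner_commute[of x "- y"] cinner_commute[of x y] m by simp
qed

lemma cinner_add_right: "cinner x (y + z) = cinner x y + cinner x (z::'a::chilbert_space)"
  using cinner_commute[of x "y + z"] cinner_commute[of x y] cinner_commute[of x z]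
  by (simp add: cinner_add_left)

lemma cinner_scaleC_right: "cinner x (c *\<^sub>C y) = cnj c * cinner x (y::'a::chilbert_space)"
  using cinner_commute[of x "c *\<^sub>C y"] cinner_commute[of x y] by (simp add: cinner_scaleC_left)

lemma cinner_diff_left: "cinner (x - y) z = cinner x z - cinner y (z::'a::chilbert_space)"
  using cinner_add_left[of x "- y" z] by simp

lemma cinner_diff_right: "cinner x (y - z) = cinner x y - cinner x (z::'a::chilbert_space)"
  using cinner_add_right[of x y "- z"] by simp

lemma cinner_scaleR_left: "cinner (a *\<^sub>R x) y = of_real a * cinner x (y::'a::chilbert_space)"
  by (simp add: scaleR_scaleC cinner_scaleC_left)

lemma cinner_scaleR_right: "cinner x (a *\<^sub>R y) = of_real a * cinner x (y::'a::chilbert_space)"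
  by (simp add: scaleR_scaleC cinner_scaleC_right)

lemmas cinner_algebra = cinner_add_left cinner_add_right cinner_diff_left cinner_diff_right
  cinner_scaleR_left cinner_scaleR_right cinner_scaleC_left cinner_scaleC_right

lemma cinner_self: "cinner x x = of_real ((norm (x::'a::chilbert_space))\<^sup>2)"
proof -
  have "Im (cinner x x) = 0"
    using arg_cong[OF cinner_commute[of x x], of Im] by simp
  then show ?thesis
    by (simp add: complex_eq_iff norm_eq_sqrt_cinner cinner_ge_zero)
qed

lemma norm_diff_sq:
  "(norm (x - y))\<^sup>2 = (norm x)\<^sup>2 + (norm y)\<^sup>2 - 2 * Re (cinner x (y::'a::chilbert_space))"
proof -
  have "(norm (x - y))\<^sup>2 = Re (cinner (x - y) (x - y))"
    by (simp add: cinner_self)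
  also have "\<dots> = (norm x)\<^sup>2 + (norm y)\<^sup>2 - Re (cinner x y) - Re (cinner y x)"
    by (simp only: cinner_diff_left cinner_diff_right) (simp add: cinner_self)
  also have "Re (cinner y x) = Re (cinner x y)"
    by (subst cinner_commute) simp
  finally show ?thesis by simp
qed

lemma norm_add_sq:
  "(norm (x + y))\<^sup>2 = (norm x)\<^sup>2 + (norm y)\<^sup>2 + 2 * Re (cinner x (y::'a::chilbert_space))"
  using norm_diff_sq[of x "- y"] by simp

lemma parallelogram_law:
  "(norm (x + y))\<^sup>2 + (norm (x - y))\<^sup>2 = 2 * (norm x)\<^sup>2 + 2 * (norm (y::'a::chilbert_space))\<^sup>2"
  by (simp add: norm_diff_sq norm_add_sq)

lemma norm_scaleC [simp]: "norm (c *\<^sub>C x) = cmod c * norm (x::'a::chilbert_space)"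
proof -
  have "(of_real ((norm (c *\<^sub>C x))\<^sup>2) :: complex) = c * cnj c * of_real ((norm x)\<^sup>2)"
    unfolding cinner_self[symmetric] by (simp add: cinner_algebra)
  also have "\<dots> = of_real ((cmod c * norm x)\<^sup>2)"
    by (simp add: complex_norm_square[symmetric] power_mult_distrib)
  finally have "(norm (c *\<^sub>C x))\<^sup>2 = (cmod c * norm x)\<^sup>2"
    unfolding of_real_eq_iff .
  then show ?thesis by (simp add: power2_eq_iff_nonneg)
qed

text \<open>Pythagoras for the part of \<open>x\<close> orthogonal to \<open>y\<close>. That the
  left side is nonnegative is Cauchy-Schwarz; that it cannot fall below a minimal distance yields
  orthogonality of a nearest point.\<close>

lemma norm_diff_projection_sq:
  fixes x y :: "'a::chilbert_space"
  assumes "y \<noteq> 0"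
  shows "(norm (x - (cinner x y / of_real ((norm y)\<^sup>2)) *\<^sub>C y))\<^sup>2
       = (norm x)\<^sup>2 - (cmod (cinner x y) / norm y)\<^sup>2"
proof -
  define c where "c = cinner x y / of_real ((norm y)\<^sup>2)"
  have "Re (cinner x (c *\<^sub>C y)) = (cmod (cinner x y) / norm y)\<^sup>2"
    by (simp add: cinner_scaleC_right c_def mult.commute complex_norm_square[symmetric] power_divide
        flip: of_real_power of_real_divide)
  moreover have "norm (c *\<^sub>C y) = cmod (cinner x y) / norm y"
    using assms by (simp add: c_def norm_divide norm_mult power2_eq_square field_simps)
  ultimately show ?thesis
    using norm_diff_sq[of x "c *\<^sub>C y"] by (simp add: c_def)
qed

section \<open>Cauchy-Schwarz and Buzano inequalities\<close>

lemma cinner_cauchy_schwarz: "cmod (cinner x y) \<le> norm x * norm (y::'a::chilbert_space)"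
proof (cases "y = 0")
  case False
  have "(cmod (cinner x y) / norm y)\<^sup>2 \<le> (norm x)\<^sup>2"
    using norm_diff_projection_sq[OF False, of x] zero_le_power2 by (metis diff_ge_0_iff_ge)
  then have "cmod (cinner x y) / norm y \<le> norm x"
    by (rule power2_le_imp_le) simp
  then show ?thesis using False by (simp add: divide_simps)
qed simp

text \<open>The vector \<open>2\<langle>x,e\<rangle>e - x\<close> is the reflection of \<open>x\<close> in the line through \<open>e\<close>, so it has the
  norm of \<open>x\<close>; the claim is the Cauchy-Schwarz inequality for it and \<open>y\<close>.\<close>

lemma buzano:
  fixes x y e :: "'a::chilbert_space"
  assumes "norm e = 1"
  shows "cmod (cinner x e) * cmod (cinner e y) \<le> (norm x * norm y + cmod (cinner x y)) / 2"
proof -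
  define z where "z = (2 * cinner x e) *\<^sub>C e - x"
  have "Re (cinner ((2 * cinner x e) *\<^sub>C e) x) = 2 * (cmod (cinner x e))\<^sup>2"
    using cinner_commute[of e x]
    by (simp add: cinner_algebra mult.assoc complex_norm_square[symmetric] flip: of_real_power)
  then have "(norm z)\<^sup>2 = (norm x)\<^sup>2"
    unfolding z_def norm_diff_sq using assms by (simp add: norm_mult power_mult_distrib)
  then have "norm z = norm x" by (simp add: power2_eq_iff_nonneg)
  have "2 * cinner x e * cinner e y = cinner z y + cinner x y"
    by (simp add: z_def cinner_algebra)
  then have "2 * (cmod (cinner x e) * cmod (cinner e y)) = cmod (cinner z y + cinner x y)"
    by (metis norm_mult norm_numeral mult.assoc)
  also have "\<dots> \<le> norm z * norm y + cmod (cinner x y)"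
    by (intro order_trans[OF norm_triangle_ineq] add_right_mono cinner_cauchy_schwarz)
  finally show ?thesis using \<open>norm z = norm x\<close> by simp
qed

lemma bounded_linear_cinner_left: "bounded_linear (\<lambda>x. cinner x (y::'a::chilbert_space))"
  by (rule bounded_linear_intro[where K = "norm y"])
     (simp_all add: cinner_algebra cinner_cauchy_schwarz scaleR_conv_of_real)

lemma bounded_linear_cinner_right: "bounded_linear (\<lambda>y. cinner (x::'a::chilbert_space) y)"
  by (rule bounded_linear_intro[where K = "norm x"])
     (simp_all add: cinner_algebra cinner_cauchy_schwarz scaleR_conv_of_real mult.commute[of _ "norm x"])

lemma cinner_ext: "(\<And>z. cinner z x = cinner z (y::'a::chilbert_space)) \<Longrightarrow> x = y"
  using cinner_eq_zero_iff[of "x - y"] by (simp add: cinner_diff_right)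

subsection \<open>Orthogonality and adjoints\<close>

text \<open>By completeness \<open>v\<close> has a nearest point \<open>l\<close> in
  \<open>V\<close>, and \<open>z = v - l\<close> is orthogonal to \<open>V\<close>.\<close>

lemma closed_subspace_orthogonal:
  fixes V :: "'a::chilbert_space set"
  assumes "closed V" "0 \<in> V" and add: "\<And>x y. x \<in> V \<Longrightarrow> y \<in> V \<Longrightarrow> x + y \<in> V"
    and scale: "\<And>c x. x \<in> V \<Longrightarrow> c *\<^sub>C x \<in> V" and "v \<notin> V"
  obtains z where "z \<noteq> 0" "\<And>u. u \<in> V \<Longrightarrow> cinner u z = 0"
proof -
  define d where "d = infdist v V"
  have "V \<noteq> {}" using assms(2) by auto
  have d_le: "d \<le> norm (v - u)" if "u \<in> V" for u
    using infdist_le[OF that, of v] by (simp add: d_def dist_norm)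
  have "d \<ge> 0" by (simp add: d_def infdist_nonneg)
  have "\<exists>u\<in>V. norm (v - u) < d + inverse (Suc n)" for n
  proof -
    have "Inf (dist v ` V) < d + inverse (Suc n)"
      using \<open>V \<noteq> {}\<close> by (simp add: d_def infdist_def)
    then show ?thesis
      using \<open>V \<noteq> {}\<close> by (subst (asm) cInf_less_iff) (auto simp: dist_norm intro: bdd_belowI2[where m = 0])
  qed
  then obtain u where uV: "\<And>n. u n \<in> V" and ud: "\<And>n. norm (v - u n) < d + inverse (Suc n)"
    by metis
  have lim: "(\<lambda>n. norm (v - u n)) \<longlonglongrightarrow> d"
  proof (rule tendsto_sandwich[where f = "\<lambda>_. d" and h = "\<lambda>n. d + inverse (real (Suc n))"])
    show "(\<lambda>n. d + inverse (real (Suc n))) \<longlonglongrightarrow> d"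
      using tendsto_add[OF tendsto_const LIMSEQ_inverse_real_of_nat, of d] by simp
    show "\<forall>\<^sub>F n in sequentially. norm (v - u n) \<le> d + inverse (real (Suc n))"
      by (intro always_eventually allI less_imp_le ud)
  qed (auto intro!: always_eventually d_le uV)
  \<comment> \<open>Parallelogram law for \<open>v - u m\<close> and \<open>v - u n\<close>: their
    sum is twice the difference of \<open>v\<close> and a midpoint lying in \<open>V\<close>, so its
    norm is at least \<open>2 * d\<close>.\<close>
  have diff_sq: "(norm (u m - u n))\<^sup>2 \<le> 2 * ((norm (v - u m))\<^sup>2 - d\<^sup>2) + 2 * ((norm (v - u n))\<^sup>2 - d\<^sup>2)"
    for m n
  proof -
    have "(1/2) *\<^sub>R (u m + u n) \<in> V"
      unfolding scaleR_scaleC by (intro scale add uV)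
    moreover have "2 * norm (v - (1/2) *\<^sub>R (u m + u n)) = norm ((v - u m) + (v - u n))"
    proof -
      have "(v - u m) + (v - u n) = 2 *\<^sub>R (v - (1/2) *\<^sub>R (u m + u n))"
        by (simp add: scaleR_diff_right scaleR_2)
      then show ?thesis by simp
    qed
    ultimately have "2 * d \<le> norm ((v - u m) + (v - u n))"
      using d_le by fastforce
    then have "(2 * d)\<^sup>2 \<le> (norm ((v - u m) + (v - u n)))\<^sup>2"
      using \<open>d \<ge> 0\<close> by (intro power_mono) auto
    moreover have "norm ((v - u m) - (v - u n)) = norm (u m - u n)"
      by (simp add: norm_minus_commute)
    ultimately show ?thesis
      using parallelogram_law[of "v - u m" "v - u n"] by (simp add: power_mult_distrib)
  qed
  have "Cauchy u"
  proof (rule metric_CauchyI)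
    fix e :: real assume "e > 0"
    have "(\<lambda>n. (norm (v - u n))\<^sup>2) \<longlonglongrightarrow> d\<^sup>2"
      by (intro tendsto_power lim)
    \<comment> \<open>With slack \<open>e\<^sup>2 / 4\<close> each of the two terms in
      \<open>diff_sq\<close> is below \<open>e\<^sup>2 / 2\<close>.\<close>
    then have "eventually (\<lambda>n. (norm (v - u n))\<^sup>2 < d\<^sup>2 + e\<^sup>2 / 4) sequentially"
      using \<open>e > 0\<close> by (intro order_tendstoD) auto
    then obtain N where N: "\<And>n. n \<ge> N \<Longrightarrow> (norm (v - u n))\<^sup>2 < d\<^sup>2 + e\<^sup>2 / 4"
      by (auto simp: eventually_sequentially)
    have "dist (u m) (u n) < e" if "m \<ge> N" "n \<ge> N" for m n
    proof -
      have "(norm (u m - u n))\<^sup>2 < e\<^sup>2"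
        using diff_sq[of m n] N[OF that(1)] N[OF that(2)] by simp
      then show ?thesis
        using \<open>e > 0\<close> power_less_imp_less_base[of _ 2 e] by (simp add: dist_norm)
    qed
    then show "\<exists>M. \<forall>m\<ge>M. \<forall>n\<ge>M. dist (u m) (u n) < e" by blast
  qed
  then obtain l where l: "u \<longlonglongrightarrow> l"
    using Cauchy_convergent_iff convergent_def by blast
  then have "l \<in> V"
    using \<open>closed V\<close> uV by (auto simp: closed_sequential_limits)
  have "norm (v - l) = d"
    by (rule LIMSEQ_unique[OF _ lim]) (intro tendsto_intros l)
  show ?thesis
  proof
    show "v - l \<noteq> 0" using \<open>l \<in> V\<close> \<open>v \<notin> V\<close> by auto
    show "cinner w (v - l) = 0" if "w \<in> V" for w
    proof (cases "w = 0")
      case False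
      \<comment> \<open>Moving \<open>l\<close> by the projection of \<open>v - l\<close> onto
        \<open>w\<close> stays in \<open>V\<close> and would shorten the distance unless the inner
        product vanishes.\<close>
      define c where "c = cinner (v - l) w / of_real ((norm w)\<^sup>2)"
      have "l + c *\<^sub>C w \<in> V" by (intro add scale that \<open>l \<in> V\<close>)
      then have "d \<le> norm (v - l - c *\<^sub>C w)"
        using d_le by (simp add: diff_diff_eq)
      then have "d\<^sup>2 \<le> (norm (v - l - c *\<^sub>C w))\<^sup>2"
        using \<open>d \<ge> 0\<close> by (intro power_mono)
      then have "cinner (v - l) w = 0"
        using norm_diff_projection_sq[OF False, of "v - l"] False \<open>norm (v - l) = d\<close>
        by (simp add: c_def)
      then show ?thesis
        by (subst cinner_commute) simp
    qed simp
  qed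
qed

text \<open>For \<open>z\<close> orthogonal to the kernel of \<open>f\<close>, the vector
  \<open>x - (f x / f z) *\<^sub>C z\<close> lies in the kernel, so \<open>cinner x z\<close>
  determines \<open>f x\<close>.\<close>

lemma riesz_representation:
  fixes f :: "'a::chilbert_space \<Rightarrow> complex"
  assumes "bounded_linear f" and hom: "\<And>c x. f (c *\<^sub>C x) = c * f x"
  shows "\<exists>y. \<forall>x. f x = cinner x y"
proof (cases "\<forall>x. f x = 0")
  case True
  then show ?thesis by (intro exI[of _ 0]) simp
next
  case False
  interpret bounded_linear f by fact
  obtain v where "f v \<noteq> 0" using False by blast
  have "closed {x. f x = 0}"
    by (intro closed_Collect_eq continuous_on_const linear_continuous_on assms)
  then obtain z where z: "z \<noteq> 0" "\<And>u. f u = 0 \<Longrightarrow> cinner u z = 0"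
    using closed_subspace_orthogonal[of "{x. f x = 0}" v] \<open>f v \<noteq> 0\<close> by (auto simp: add zero hom)
  have fz: "f z \<noteq> 0" using z cinner_eq_zero_iff by blast
  show ?thesis
  proof (intro exI allI)
    fix x
    have "f (x - (f x / f z) *\<^sub>C z) = 0"
      using fz by (simp add: diff hom)
    from z(2)[OF this] have "cinner x z = f x / f z * of_real ((norm z)\<^sup>2)"
      by (simp add: cinner_algebra cinner_self)
    then show "f x = cinner x (cnj (f z / of_real ((norm z)\<^sup>2)) *\<^sub>C z)"
      using fz z(1) by (simp add: cinner_scaleC_right)
  qed
qed

text \<open>Riesz representation of the functional sending \<open>x\<close> to
  \<open>cinner (T x) y\<close>, for each \<open>y\<close>; uniqueness of the representing vector
  makes it linear in \<open>y\<close>.\<close>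

lemma adj_exists:
  fixes T :: "'a::chilbert_space \<Rightarrow>\<^sub>L 'a"
  assumes "T \<in> bounded_ops"
  shows "\<exists>S\<in>bounded_ops. \<forall>x y. cinner (T x) y = cinner x (blinfun_apply S y)"
proof -
  have "\<exists>z. \<forall>x. cinner (T x) y = cinner x z" for y
  proof (rule riesz_representation)
    show "bounded_linear (\<lambda>x. cinner (T x) y)"
      by (intro bounded_linear_compose[OF bounded_linear_cinner_left] blinfun.bounded_linear_right)
    show "cinner (T (c *\<^sub>C x)) y = c * cinner (T x) y" for c x
      using assms by (simp add: bounded_ops_def cinner_scaleC_left)
  qed
  then obtain s where s: "\<And>x y. cinner (T x) y = cinner x (s y)" by metis
  have add: "s (x + y) = s x + s y" for x y
    by (rule cinner_ext) (simp add: s[symmetric] cinner_add_right)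
  have scale: "s (c *\<^sub>C x) = c *\<^sub>C s x" for c x
    by (rule cinner_ext) (simp add: s[symmetric] cinner_scaleC_right)
  \<comment> \<open>Testing the defining identity at \<open>x = s y\<close> and cancelling one
    factor \<open>norm (s y)\<close>.\<close>
  have "norm (s y) \<le> norm y * norm T" for y
  proof -
    have "(norm (s y))\<^sup>2 = cmod (cinner (T (s y)) y)"
      by (simp add: s cinner_self norm_power)
    also have "\<dots> \<le> norm T * norm (s y) * norm y"
      by (intro order_trans[OF cinner_cauchy_schwarz] mult_right_mono norm_blinfun) simp
    finally show ?thesis
      by (cases "norm (s y) = 0") (simp_all add: power2_eq_square mult_ac)
  qed
  then have "bounded_linear s"
    by (intro bounded_linear_intro[where K = "norm T"]) (auto simp: add scaleR_scaleC scale)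
  then have "blinfun_apply (Blinfun s) = s" by (rule bounded_linear_Blinfun_apply)
  then show ?thesis
    by (intro bexI[of _ "Blinfun s"]) (simp_all add: bounded_ops_def s scale)
qed

lemma
  assumes "T \<in> bounded_ops"
  shows adj_in_bounded_ops: "adj T \<in> bounded_ops"
    and cinner_adj_right: "cinner (blinfun_apply T x) y = cinner x (blinfun_apply (adj T) y)"
proof -
  have "\<exists>!S. S \<in> bounded_ops \<and> (\<forall>x y. cinner (T x) y = cinner x (blinfun_apply S y))"
  proof (rule ex_ex1I)
    show "\<exists>S. S \<in> bounded_ops \<and> (\<forall>x y. cinner (T x) y = cinner x (blinfun_apply S y))"
      using adj_exists[OF assms] by blast
    show "S = S'" if "S \<in> bounded_ops \<and> (\<forall>x y. cinner (T x) y = cinner x (blinfun_apply S y))"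
      "S' \<in> bounded_ops \<and> (\<forall>x y. cinner (T x) y = cinner x (blinfun_apply S' y))" for S S'
      by (intro blinfun_eqI cinner_ext) (metis that)
  qed
  from theI'[OF this] show "adj T \<in> bounded_ops"
    and "cinner (blinfun_apply T x) y = cinner x (blinfun_apply (adj T) y)"
    unfolding adj_def by blast+
qed

subsection \<open>Self-adjoint operators and their real polynomials\<close>

text \<open>Expressed by symmetry of the form rather than by \<open>adj A = A\<close>, so that it
  can be checked without unfolding a definite description.\<close>

definition self_adjoint :: "('a::chilbert_space \<Rightarrow>\<^sub>L 'a) \<Rightarrow> bool" where
  "self_adjoint A \<longleftrightarrow> A \<in> bounded_ops \<and>
     (\<forall>x y. cinner (blinfun_apply A x) y = cinner x (blinfun_apply A y))"

lemma self_adjointD: "self_adjoint A \<Longrightarrow> cinner (blinfun_apply A x) y = cinner x (blinfun_apply A y)"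
  by (simp add: self_adjoint_def)

lemma self_adjoint_in_bounded_ops: "self_adjoint A \<Longrightarrow> A \<in> bounded_ops"
  by (simp add: self_adjoint_def)

lemma self_adjoint_id: "self_adjoint id_blinfun"
  by (simp add: self_adjoint_def bounded_ops_def)

lemma self_adjoint_zero: "self_adjoint 0"
  by (simp add: self_adjoint_def bounded_ops_def)

lemma self_adjoint_add: "self_adjoint A \<Longrightarrow> self_adjoint B \<Longrightarrow> self_adjoint (A + B)"
  by (simp add: self_adjoint_def bounded_ops_def blinfun.add_left cinner_algebra scaleC_add_right)

lemma self_adjoint_scaleR: "self_adjoint A \<Longrightarrow> self_adjoint (c *\<^sub>R A)"
  by (simp add: self_adjoint_def bounded_ops_def blinfun.scaleR_left cinner_algebra)
     (simp add: scaleR_scaleC scaleC_scaleC mult.commute)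

lemma self_adjoint_compose:
  assumes "self_adjoint A" "self_adjoint B" "A o\<^sub>L B = B o\<^sub>L A"
  shows "self_adjoint (A o\<^sub>L B)"
proof -
  have "A (B y) = B (A y)" for y
    using arg_cong[OF assms(3), of "\<lambda>C. blinfun_apply C y"] by simp
  then have "cinner (A (B x)) y = cinner x (A (B y))" for x y
    using assms(1,2) by (simp add: self_adjointD)
  then show ?thesis
    using assms(1,2) by (simp add: self_adjoint_def bounded_ops_def)
qed

lemma self_adjoint_limit:
  assumes "\<And>n. self_adjoint (B n)" "B \<longlonglongrightarrow> C"
  shows "self_adjoint C"
proof -
  have lim: "(\<lambda>n. B n x) \<longlonglongrightarrow> C x" for x
    by (intro tendsto_intros assms)
  have scaleC_lim: "(\<lambda>n. c *\<^sub>C g n) \<longlonglongrightarrow> c *\<^sub>C l" if "g \<longlonglongrightarrow> l" for c and g :: "nat \<Rightarrow> 'a" and l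
  proof -
    have "bounded_linear (\<lambda>x::'a. c *\<^sub>C x)"
      by (rule bounded_linear_intro[where K = "cmod c"])
         (simp_all add: scaleC_add_right scaleR_scaleC scaleC_scaleC mult.commute)
    then show ?thesis by (rule bounded_linear.tendsto[OF _ that])
  qed
  have "C (c *\<^sub>C x) = c *\<^sub>C C x" for c x
    by (rule LIMSEQ_unique[OF lim])
       (use assms(1) scaleC_lim[OF lim] in \<open>simp add: self_adjoint_def bounded_ops_def\<close>)
  moreover have "cinner (C x) y = cinner x (C y)" for x y
  proof (rule LIMSEQ_unique)
    show "(\<lambda>n. cinner (B n x) y) \<longlonglongrightarrow> cinner (C x) y"
      by (intro bounded_linear.tendsto[OF bounded_linear_cinner_left] lim)
    show "(\<lambda>n. cinner (B n x) y) \<longlonglongrightarrow> cinner x (C y)"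
      unfolding self_adjointD[OF assms(1)]
      by (intro bounded_linear.tendsto[OF bounded_linear_cinner_right] lim)
  qed
  ultimately show ?thesis by (simp add: self_adjoint_def bounded_ops_def)
qed

lemma cinner_self_adjoint_square:
  "self_adjoint A \<Longrightarrow> cinner (blinfun_apply A (blinfun_apply A x)) x = of_real ((norm (A x))\<^sup>2)"
  by (simp add: self_adjointD cinner_self flip: of_real_power)

section \<open>Real polynomials of an operator\<close>

lemmas blinfun_compose_bilinear =
  bounded_bilinear.add_right[OF bounded_bilinear_blinfun_compose]
  bounded_bilinear.scaleR_right[OF bounded_bilinear_blinfun_compose]
  bounded_bilinear.sum_right[OF bounded_bilinear_blinfun_compose]

lemma op_poly_0 [simp]: "op_poly 0 A = 0"
  by (simp add: op_poly_def)

lemma op_poly_pCons [simp]: "op_poly (pCons a p) A = a *\<^sub>R id_blinfun + (A o\<^sub>L op_poly p A)"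
proof (cases "p = 0")
  case False
  then show ?thesis
    by (simp add: op_poly_def sum.atMost_Suc_shift blinfun_compose_bilinear del: sum.atMost_Suc)
qed (simp add: op_poly_def)

lemma op_poly_add: "op_poly (p + q) A = op_poly p A + op_poly q A"
  by (induction p q rule: poly_induct2)
     (simp_all add: scaleR_add_left blinfun_compose_bilinear)

lemma op_poly_smult: "op_poly (smult c p) A = c *\<^sub>R op_poly p A"
  by (induction p) (simp_all add: scaleR_add_right blinfun_compose_bilinear)

lemma op_poly_diff: "op_poly (p - q) A = op_poly p A - op_poly q A"
  using op_poly_add[of p "smult (-1) q" A] op_poly_smult[of "-1" q A] by simp

lemma op_poly_mult: "op_poly (p * q) A = op_poly p A o\<^sub>L op_poly q A"
proof (induction p)
  case (pCons a p)
  then show ?case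
    by (intro blinfun_eqI)
       (simp add: op_poly_add op_poly_smult blinfun.add_left blinfun.scaleR_left)
qed simp

lemma self_adjoint_op_poly: "self_adjoint A \<Longrightarrow> self_adjoint (op_poly p A)"
proof (induction p)
  case (pCons a p)
  \<comment> \<open>\<open>A\<close> commutes with \<open>op_poly p A\<close> because multiplication
    of polynomials is commutative.\<close>
  have "A o\<^sub>L op_poly p A = op_poly ([:0, 1:] * p) A"
    by simp
  also have "\<dots> = op_poly (p * [:0, 1:]) A"
    by (simp only: mult.commute)
  also have "\<dots> = op_poly p A o\<^sub>L A"
    unfolding op_poly_mult by (intro blinfun_eqI) simp
  finally show ?case
    using pCons by (simp add: self_adjoint_add self_adjoint_scaleR self_adjoint_id self_adjoint_compose)
qed (simp add: self_adjoint_zero)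

text \<open>A substitute for invertibility: for \<open>A - t\<close> with \<open>A\<close>
  self-adjoint and \<open>t\<close> real the two agree, and this one is inherited by compositions
  without constructing an inverse.\<close>

definition bounded_below_op :: "('a::chilbert_space \<Rightarrow>\<^sub>L 'a) \<Rightarrow> bool" where
  "bounded_below_op A \<longleftrightarrow> (\<exists>c>0. \<forall>x. c * norm x \<le> norm (blinfun_apply A x))"

lemma bounded_below_op_compose:
  assumes "bounded_below_op A" "bounded_below_op B"
  shows "bounded_below_op (A o\<^sub>L B)"
proof -
  obtain c d where c: "c > 0" "\<And>x. c * norm x \<le> norm (A x)"
    and d: "d > 0" "\<And>x. d * norm x \<le> norm (B x)"
    using assms unfolding bounded_below_op_def by blast
  have "c * d * norm x \<le> norm (A (B x))" for x
    using order_trans[OF mult_left_mono[OF d(2)[of x], of c] c(2)[of "B x"]] c(1) by (simp add: mult.assoc)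
  then show ?thesis
    unfolding bounded_below_op_def using c(1) d(1) by (intro exI[of _ "c * d"]) simp
qed

section \<open>The real spectrum of a self-adjoint operator\<close>

abbreviation real_spectrum :: "('a::chilbert_space \<Rightarrow>\<^sub>L 'a) \<Rightarrow> real set" where
  "real_spectrum A \<equiv> {t. complex_of_real t \<in> spectrum A}"

lemma op_poly_linear_apply: "op_poly [:- t, 1:] A x = A x - complex_of_real t *\<^sub>C x"
  by (simp add: blinfun.bilinear_simps scaleR_scaleC[symmetric])

lemma bounded_below_op_if_not_in_spectrum:
  fixes A :: "'a::chilbert_space \<Rightarrow>\<^sub>L 'a"
  assumes "t \<notin> real_spectrum A"
  shows "bounded_below_op (op_poly [:- t, 1:] A)"
proof -
  obtain B :: "'a \<Rightarrow>\<^sub>L 'a" where B: "\<And>x. B (A x - complex_of_real t *\<^sub>C x) = x"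
    using assms unfolding spectrum_def by blast
  \<comment> \<open>The norm of the inverse \<open>B\<close> gives the lower bound; the added 1
    keeps the constant positive on the zero space, where \<open>B = 0\<close>.\<close>
  have "inverse (norm B + 1) * norm x \<le> norm (op_poly [:- t, 1:] A x)" for x
  proof -
    let ?y = "A x - complex_of_real t *\<^sub>C x"
    have "norm x \<le> norm B * norm ?y"
      using norm_blinfun[of B ?y] B[of x] by simp
    also have "\<dots> \<le> (norm B + 1) * norm ?y"
      by (intro mult_right_mono) auto
    finally show ?thesis
      by (simp add: op_poly_linear_apply field_simps add_pos_nonneg pos_add_strict del: op_poly_pCons)
  qed
  moreover have "norm B + 1 > 0" by (simp add: add_nonneg_pos)
  ultimately show ?thesis
    unfolding bounded_below_op_def by (intro exI[of _ "inverse (norm B + 1)"]) simp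
qed

text \<open>A self-adjoint operator that is bounded below has closed range, and a vector orthogonal to
  the range lies in the kernel.\<close>

lemma not_in_spectrum_if_bounded_below_op:
  assumes "self_adjoint A" "bounded_below_op (op_poly [:- t, 1:] A)"
  shows "t \<notin> real_spectrum A"
proof -
  define B where "B = op_poly [:- t, 1:] A"
  have B: "self_adjoint B"
    unfolding B_def by (intro self_adjoint_op_poly assms)
  have B_apply: "B x = A x - complex_of_real t *\<^sub>C x" for x
    unfolding B_def by (rule op_poly_linear_apply)
  obtain c where c: "c > 0" "\<And>x. c * norm x \<le> norm (B x)"
    using assms(2) unfolding bounded_below_op_def B_def by blast
  have kernel: "x = 0" if "B x = 0" for x
    using c(2)[of x] c(1) that by (simp add: mult_le_0_iff)
  have B_scale: "B (a *\<^sub>C x) = a *\<^sub>C B x" for a x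
    using self_adjoint_in_bounded_ops[OF B] by (simp add: bounded_ops_def)
  have "inj (blinfun_apply B)"
    by (rule injI) (metis kernel blinfun.diff_right right_minus_eq)
  have "closed (range (blinfun_apply B))"
  proof -
    have "complete (range (blinfun_apply B))"
      by (rule complete_isometric_image[OF c(1)])
         (auto simp: c blinfun.bounded_linear_right complete_UNIV)
    then show ?thesis by (rule complete_imp_closed)
  qed
  have "surj (blinfun_apply B)"
  proof (rule ccontr)
    assume "\<not> surj (blinfun_apply B)"
    then obtain v where v: "v \<notin> range (blinfun_apply B)" by auto
    have zero: "0 \<in> range (blinfun_apply B)"
      by (rule image_eqI[of _ _ 0]) simp_all
    have add: "x + y \<in> range (blinfun_apply B)"
      if "x \<in> range (blinfun_apply B)" "y \<in> range (blinfun_apply B)" for x y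
      using that by (elim rangeE) (simp only: blinfun.add_right[symmetric] rangeI)
    have scale: "a *\<^sub>C x \<in> range (blinfun_apply B)" if "x \<in> range (blinfun_apply B)" for a x
      using that by (elim rangeE) (simp only: B_scale[symmetric] rangeI)
    obtain z where "z \<noteq> 0" and z: "\<And>u. u \<in> range (blinfun_apply B) \<Longrightarrow> cinner u z = 0"
      by (rule closed_subspace_orthogonal[OF \<open>closed (range (blinfun_apply B))\<close> zero add scale v],
          assumption+) (rule that)
    have "cinner x (B z) = cinner x 0" for x
      using z[OF rangeI, of x] by (simp add: self_adjointD[OF B])
    then have "B z = 0" by (rule cinner_ext)
    then show False using kernel \<open>z \<noteq> 0\<close> by blast
  qed
  \<comment> \<open>The inverse is complex-linear because \<open>B\<close> is, and its norm is at
    most \<open>inverse c\<close> by the lower bound for \<open>B\<close>.\<close>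
  define G where "G = inv (blinfun_apply B)"
  have GB: "G (B x) = x" for x
    unfolding G_def by (rule inv_f_f[OF \<open>inj (blinfun_apply B)\<close>])
  have BG: "B (G x) = x" for x
    unfolding G_def by (rule surj_f_inv_f[OF \<open>surj (blinfun_apply B)\<close>])
  have G_scale: "G (a *\<^sub>C x) = a *\<^sub>C G x" for a x
    by (metis GB BG B_scale)
  have "bounded_linear G"
  proof (rule bounded_linear_intro[where K = "inverse c"])
    show "G (x + y) = G x + G y" for x y
      by (metis GB BG blinfun.add_right)
    show "G (a *\<^sub>R x) = a *\<^sub>R G x" for a x
      by (simp add: scaleR_scaleC G_scale)
    show "norm (G x) \<le> norm x * inverse c" for x
      using c(1) c(2)[of "G x"] by (simp add: BG field_simps)
  qed
  then have Blinfun_G: "blinfun_apply (Blinfun G) = G" by (rule bounded_linear_Blinfun_apply)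
  have "Blinfun G \<in> bounded_ops"
    by (simp add: bounded_ops_def Blinfun_G G_scale)
  moreover have "Blinfun G (A x - complex_of_real t *\<^sub>C x) = x" for x
    by (simp add: Blinfun_G GB flip: B_apply)
  moreover have "A (Blinfun G x) - complex_of_real t *\<^sub>C Blinfun G x = x" for x
    by (simp add: Blinfun_G BG flip: B_apply)
  ultimately show ?thesis
    unfolding spectrum_def by blast
qed

text \<open>If \<bar>t\<bar> exceeds \<open>norm A\<close>, the reverse triangle inequality bounds
  \<open>A - t\<close> below by the difference.\<close>

lemma real_spectrum_le_norm:
  assumes "self_adjoint A" "t \<in> real_spectrum A"
  shows "\<bar>t\<bar> \<le> norm A"
proof (rule ccontr)
  assume t: "\<not> \<bar>t\<bar> \<le> norm A"
  have "(\<bar>t\<bar> - norm A) * norm x \<le> norm (op_poly [:- t, 1:] A x)" for x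
  proof -
    have "\<bar>t\<bar> * norm x - norm A * norm x \<le> norm (complex_of_real t *\<^sub>C x) - norm (A x)"
      using norm_blinfun[of A x] by simp
    also have "\<dots> \<le> norm (A x - complex_of_real t *\<^sub>C x)"
      by (metis norm_minus_commute norm_triangle_ineq2)
    finally show ?thesis
      unfolding op_poly_linear_apply by (simp add: left_diff_distrib)
  qed
  then have "bounded_below_op (op_poly [:- t, 1:] A)"
    unfolding bounded_below_op_def using t by (intro exI[of _ "\<bar>t\<bar> - norm A"]) (auto simp del: op_poly_pCons)
  with not_in_spectrum_if_bounded_below_op[OF assms(1)] assms(2) show False by blast
qed

text \<open>For negative \<open>t\<close> the form of \<open>A - t\<close> is at least
  \<open>- t * (norm x)\<^sup>2\<close>, and Cauchy-Schwarz turns this into a lower bound for the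
  norm.\<close>

lemma real_spectrum_nonneg:
  assumes "self_adjoint A" and pos: "\<And>x. 0 \<le> Re (cinner (A x) x)" and "t \<in> real_spectrum A"
  shows "0 \<le> t"
proof (rule ccontr)
  assume t: "\<not> 0 \<le> t"
  have "- t * norm x \<le> norm (op_poly [:- t, 1:] A x)" for x
  proof (cases "x = 0")
    case False
    let ?y = "A x - complex_of_real t *\<^sub>C x"
    have "- t * (norm x)\<^sup>2 \<le> Re (cinner ?y x)"
      using pos[of x] by (simp add: cinner_algebra cinner_self flip: of_real_power)
    also have "\<dots> \<le> norm ?y * norm x"
      by (rule order_trans[OF complex_Re_le_cmod cinner_cauchy_schwarz])
    finally have "(- t * norm x) * norm x \<le> norm ?y * norm x"
      by (simp add: power2_eq_square)
    then show ?thesis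
      unfolding op_poly_linear_apply using False by (simp only: mult_le_cancel_right) auto
  qed simp
  then have "bounded_below_op (op_poly [:- t, 1:] A)"
    unfolding bounded_below_op_def using t by (intro exI[of _ "- t"]) (auto simp del: op_poly_pCons)
  with not_in_spectrum_if_bounded_below_op[OF assms(1)] assms(3) show False by blast
qed

subsection \<open>Spectral bounds for real polynomials\<close>

lemma poly_map_of_real_add:
  "poly (map_poly complex_of_real (p + q)) z = poly (map_poly complex_of_real p) z + poly (map_poly complex_of_real q) z"
  by (induction p q rule: poly_induct2) (simp_all add: map_poly_pCons algebra_simps)

lemma poly_map_of_real_mult:
  "poly (map_poly complex_of_real (p * q)) z = poly (map_poly complex_of_real p) z * poly (map_poly complex_of_real q) z"
proof (induction p)
  case (pCons a p)
  have "poly (map_poly complex_of_real (smult a q)) z = of_real a * poly (map_poly complex_of_real q) z"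
    by (simp add: map_poly_smult)
  with pCons show ?case
    by (simp add: poly_map_of_real_add map_poly_pCons algebra_simps)
qed simp

text \<open>A complex root exists; a real one splits off a linear factor, a nonreal one a quadratic
  factor. The latter is kept as a sum of squares, the form in which its operator is visibly bounded
  below.\<close>

lemma real_poly_factor:
  fixes p :: "real poly"
  assumes "degree p > 0"
  obtains (linear) t q where "p = [:- t, 1:] * q"
    | (quadratic) a b q where "b \<noteq> 0" "p = ([:- a, 1:] * [:- a, 1:] + [:b\<^sup>2:]) * q"
proof -
  let ?c = "map_poly complex_of_real"
  have "\<not> constant (poly (?c p))"
    using assms by (simp add: constant_degree degree_map_poly)
  then obtain z where z: "poly (?c p) z = 0"
    using fundamental_theorem_of_algebra by blast
  show thesis
  proof (cases "Im z = 0")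
    case True
    then have "poly (?c p) (of_real (Re z)) = of_real (poly p (Re z))"
      by (induction p) (simp_all add: map_poly_pCons)
    then have "poly p (Re z) = 0"
      using z True by (simp add: complex_is_Real_iff)
    then show thesis
      using linear by (auto simp: poly_eq_0_iff_dvd elim: dvdE)
  next
    case False
    define a b where "a = Re z" and "b = Im z"
    define m where "m = [:- a, 1:] * [:- a, 1:] + [:b\<^sup>2:]"
    have m: "m = [:a\<^sup>2 + b\<^sup>2, - 2 * a, 1:]"
      by (simp add: m_def power2_eq_square)
    have "poly (?c m) z = 0"
      unfolding m a_def b_def
      by (simp add: map_poly_pCons complex_eq_iff power2_eq_square algebra_simps)
    moreover have "poly (?c p) z = poly (?c m) z * poly (?c (p div m)) z + poly (?c (p mod m)) z"
      by (simp flip: poly_map_of_real_mult poly_map_of_real_add)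
    ultimately have r0: "poly (?c (p mod m)) z = 0"
      using z by simp
    have "degree (p mod m) < 2"
      using degree_mod_less[of m p] m by auto
    moreover define u v where "u = coeff (p mod m) 1" and "v = coeff (p mod m) 0"
    ultimately have uv: "p mod m = [:v, u:]"
      by (intro poly_eqI) (auto simp: coeff_pCons coeff_eq_0 split: nat.split)
    \<comment> \<open>The remainder has real coefficients and degree at most 1 but vanishes at the
      nonreal \<open>z\<close>: the imaginary part gives \<open>u = 0\<close>, then the real part
      \<open>v = 0\<close>.\<close>
    then have "u = 0" "v = 0"
      using r0 False by (auto simp: map_poly_pCons complex_eq_iff)
    then have "p = m * (p div m)"
      using uv mult_div_mod_eq[of m p] by simp
    then show thesis
      using quadratic[of b a "p div m"] False by (simp add: m_def b_def)
  qed
qed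

text \<open>Induction on the degree, splitting off one real factor. Roots of linear factors lie
  outside the spectrum by hypothesis.\<close>

lemma bounded_below_op_poly:
  assumes "self_adjoint A" "p \<noteq> 0" "\<And>t. t \<in> real_spectrum A \<Longrightarrow> poly p t \<noteq> 0"
  shows "bounded_below_op (op_poly p A)"
  using assms(2,3)
proof (induction "degree p" arbitrary: p rule: less_induct)
  case less
  show ?case
  proof (cases "degree p = 0")
    case True
    then obtain a where "p = [:a:]" by (rule degree_eq_zeroE)
    then have "op_poly p A x = a *\<^sub>R x" "a \<noteq> 0" for x
      using less.prems(1) by (simp_all add: blinfun.scaleR_left)
    then show ?thesis
      unfolding bounded_below_op_def by (intro exI[of _ "\<bar>a\<bar>"]) simp
  next
    case False
    then have "degree p > 0" by simp
    then show ?thesis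
    proof (cases rule: real_poly_factor)
      case (linear t q)
      have "bounded_below_op (op_poly q A)"
      proof (rule less.hyps)
        show "q \<noteq> 0" using linear less.prems(1) by auto
        then show "degree q < degree p"
          unfolding linear by (subst degree_mult_eq) auto
        show "poly q s \<noteq> 0" if "s \<in> real_spectrum A" for s
          using less.prems(2)[OF that] linear by auto
      qed
      moreover have "bounded_below_op (op_poly [:- t, 1:] A)"
      proof (rule bounded_below_op_if_not_in_spectrum)
        show "t \<notin> real_spectrum A"
          using less.prems(2)[of t] linear by auto
      qed
      ultimately show ?thesis
        unfolding linear op_poly_mult by (intro bounded_below_op_compose)
    next
      case (quadratic a b q)
      let ?m = "[:- a, 1:] * [:- a, 1:] + [:b\<^sup>2:]"
      have "bounded_below_op (op_poly q A)"
      proof (rule less.hyps)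
        show "q \<noteq> 0" using quadratic less.prems(1) by auto
        then show "degree q < degree p"
          unfolding quadratic by (subst degree_mult_eq) auto
        show "poly q s \<noteq> 0" if "s \<in> real_spectrum A" for s
          using less.prems(2)[OF that] quadratic by auto
      qed
      moreover have "bounded_below_op (op_poly ?m A)"
      proof -
        define B where "B = op_poly [:- a, 1:] A"
        have B: "self_adjoint B"
          unfolding B_def by (intro self_adjoint_op_poly assms)
        have m_apply: "op_poly ?m A x = B (B x) + b\<^sup>2 *\<^sub>R x" for x
          unfolding op_poly_add op_poly_mult B_def[symmetric]
          by (simp add: blinfun.bilinear_simps)
        \<comment> \<open>The form of \<open>B (B x)\<close> is the square of
          \<open>norm (B x)\<close>, so only the term with \<open>b\<^sup>2\<close> is kept.\<close>
        have below: "b\<^sup>2 * norm x \<le> norm (op_poly ?m A x)" for x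
        proof (cases "x = 0")
          case False
          have "b\<^sup>2 * (norm x)\<^sup>2 \<le> Re (cinner (op_poly ?m A x) x)"
            unfolding m_apply cinner_add_left cinner_self_adjoint_square[OF B] cinner_scaleR_left cinner_self
            by simp
          also have "\<dots> \<le> norm (op_poly ?m A x) * norm x"
            by (rule order_trans[OF complex_Re_le_cmod cinner_cauchy_schwarz])
          finally have "(b\<^sup>2 * norm x) * norm x \<le> norm (op_poly ?m A x) * norm x"
            by (simp only: power2_eq_square mult.assoc)
          then show ?thesis
            using False by (simp only: mult_le_cancel_right) auto
        qed simp
        show ?thesis
          unfolding bounded_below_op_def
          by (intro exI[of _ "b\<^sup>2"] conjI allI below) (simp add: quadratic(1))
      qed
      ultimately show ?thesis
        unfolding quadratic(2) op_poly_mult by (intro bounded_below_op_compose)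
    qed
  qed
qed

text \<open>For \<open>C = B - m \<ge> 0\<close> the expansion of \<open>0 \<le> \<langle>C(x - sCx), x - sCx\<rangle>\<close> at \<open>s = 1/K\<close>, \<open>K > \<parallel>C\<parallel>\<close>, gives
  \<open>\<parallel>Cx\<parallel>\<^sup>2 \<le> K\<langle>Cx, x\<rangle>\<close>; so if \<open>C\<close> were bounded below, \<open>m\<close> could be increased.\<close>

lemma quadratic_form_infimum:
  fixes B :: "'a::chilbert_space \<Rightarrow>\<^sub>L 'a" and x0 :: 'a
  assumes B: "self_adjoint B" and "x0 \<noteq> 0"
  obtains m where "\<And>x. m * (norm x)\<^sup>2 \<le> Re (cinner (B x) x)"
    "\<not> bounded_below_op (op_poly [:- m, 1:] B)"
proof -
  define S where "S = {Re (cinner (B x) x) | x. norm x = 1}"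
  define m where "m = Inf S"
  have "S \<noteq> {}"
    using \<open>x0 \<noteq> 0\<close> by (auto simp: S_def intro!: exI[of _ "x0 /\<^sub>R norm x0"])
  have "bdd_below S"
  proof (rule bdd_belowI)
    fix y assume "y \<in> S"
    then obtain x where x: "norm x = 1" "y = Re (cinner (B x) x)" by (auto simp: S_def)
    have "\<bar>y\<bar> \<le> norm (B x) * norm x"
      unfolding x(2) by (rule order_trans[OF abs_Re_le_cmod cinner_cauchy_schwarz])
    also have "\<dots> \<le> norm B"
      using norm_blinfun[of B x] x(1) by simp
    finally show "- norm B \<le> y" by simp
  qed
  \<comment> \<open>Passage between unit vectors, where \<open>m\<close> is an infimum, and the
    homogeneous inequality on all vectors.\<close>
  have lower_iff: "(\<forall>x. k * (norm x)\<^sup>2 \<le> Re (cinner (B x) x)) \<longleftrightarrow> (\<forall>y\<in>S. k \<le> y)" for k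
  proof safe
    fix y assume "\<forall>x. k * (norm x)\<^sup>2 \<le> Re (cinner (B x) x)" "y \<in> S"
    then obtain x where "norm x = 1" "y = Re (cinner (B x) x)" by (auto simp: S_def)
    then show "k \<le> y" using spec[OF \<open>\<forall>x. k * (norm x)\<^sup>2 \<le> Re (cinner (B x) x)\<close>, of x] by simp
  next
    fix x assume *: "\<forall>y\<in>S. k \<le> y"
    show "k * (norm x)\<^sup>2 \<le> Re (cinner (B x) x)"
    proof (cases "x = 0")
      case False
      define e where "e = x /\<^sub>R norm x"
      have "norm e = 1" using False by (simp add: e_def)
      with * have "k \<le> Re (cinner (B e) e)" by (auto simp: S_def)
      also have "\<dots> = Re (cinner (B x) x) / (norm x)\<^sup>2"
        by (simp add: e_def blinfun.scaleR_right cinner_algebra power2_eq_square divide_simps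
            flip: of_real_inverse)
      finally show ?thesis using False by (simp add: field_simps)
    qed simp
  qed
  have lower: "m * (norm x)\<^sup>2 \<le> Re (cinner (B x) x)" for x
    using lower_iff[of m] cInf_lower[OF _ \<open>bdd_below S\<close>] unfolding m_def by blast
  define C where "C = op_poly [:- m, 1:] B"
  have C: "self_adjoint C"
    unfolding C_def by (intro self_adjoint_op_poly B)
  have C_form: "Re (cinner (C x) x) = Re (cinner (B x) x) - m * (norm x)\<^sup>2" for x
    unfolding C_def op_poly_linear_apply by (simp add: cinner_algebra cinner_self flip: of_real_power)
  have "\<not> bounded_below_op C"
  proof
    assume "bounded_below_op C"
    then obtain c where c: "c > 0" "\<And>x. c * norm x \<le> norm (C x)"
      unfolding bounded_below_op_def by blast
    define K where "K = norm C + 1"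
    have "K > 0" by (simp add: K_def add_nonneg_pos)
    have "c\<^sup>2 / K * (norm x)\<^sup>2 \<le> Re (cinner (C x) x)" for x
    proof -
      define n where "n = (norm (C x))\<^sup>2"
      have CC: "cinner (C (C x)) x = of_real n"
        unfolding n_def by (rule cinner_self_adjoint_square[OF C])
      have "Re (cinner (C (C x)) (C x)) \<le> norm (C (C x)) * norm (C x)"
        by (rule order_trans[OF complex_Re_le_cmod cinner_cauchy_schwarz])
      also have "\<dots> \<le> K * norm (C x) * norm (C x)"
        by (intro mult_right_mono order_trans[OF norm_blinfun]) (auto simp: K_def)
      finally have "Re (cinner (C (C x)) (C x)) \<le> K * n"
        by (simp add: n_def power2_eq_square mult_ac)
      then have "Re (cinner (C (C x)) (C x)) / K\<^sup>2 \<le> K * n / K\<^sup>2"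
        by (intro divide_right_mono) auto
      also have "\<dots> = n / K" using \<open>K > 0\<close> by (simp add: power2_eq_square)
      finally have top: "Re (cinner (C (C x)) (C x)) / K\<^sup>2 \<le> n / K" .
      define y where "y = x - (1 / K) *\<^sub>R C x"
      have "0 \<le> Re (cinner (C y) y)"
        using lower[of y] C_form[of y] by simp
      also have "cinner (C y) y = cinner (C x) x - 2 * of_real (n / K)
          + cinner (C (C x)) (C x) / of_real (K\<^sup>2)"
        unfolding y_def using \<open>K > 0\<close>
        by (simp add: blinfun.bilinear_simps cinner_algebra CC)
           (simp add: cinner_self n_def power2_eq_square field_simps)
      finally have "n / K \<le> Re (cinner (C x) x)"
        using top by (simp add: Re_divide_of_real del: of_real_power of_real_divide)
      moreover have "(c * norm x)\<^sup>2 \<le> n"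
        unfolding n_def using c by (intro power_mono) auto
      ultimately show ?thesis
        using \<open>K > 0\<close> by (simp add: power_mult_distrib field_simps)
    qed
    then have "(m + c\<^sup>2 / K) * (norm x)\<^sup>2 \<le> Re (cinner (B x) x)" for x
      unfolding C_form distrib_right by (simp only: le_diff_eq add.commute)
    then have "m + c\<^sup>2 / K \<le> y" if "y \<in> S" for y
      using lower_iff that by blast
    then have "m + c\<^sup>2 / K \<le> Inf S"
      by (intro cInf_greatest \<open>S \<noteq> {}\<close>)
    then show False
      using \<open>c > 0\<close> \<open>K > 0\<close> by (simp add: m_def divide_le_0_iff)
  qed
  with lower show thesis
    unfolding C_def by (rule that)
qed

lemma op_poly_form_lower_bound:
  fixes A :: "'a::chilbert_space \<Rightarrow>\<^sub>L 'a" and x0 :: 'a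
  assumes A: "self_adjoint A" and "x0 \<noteq> 0"
  obtains t where "t \<in> real_spectrum A"
    "\<And>x. poly p t * (norm x)\<^sup>2 \<le> Re (cinner (op_poly p A x) x)"
proof -
  \<comment> \<open>The real spectrum is nonempty; this supplies the point when \<open>p\<close> is
    the constant \<open>m\<close>.\<close>
  obtain s where s: "s \<in> real_spectrum A"
  proof -
    obtain m where "\<not> bounded_below_op (op_poly [:- m, 1:] A)"
      using quadratic_form_infimum[OF assms] by blast
    then show thesis
      using that bounded_below_op_if_not_in_spectrum by blast
  qed
  obtain m where m: "\<And>x. m * (norm x)\<^sup>2 \<le> Re (cinner (op_poly p A x) x)"
    and not_below: "\<not> bounded_below_op (op_poly [:- m, 1:] (op_poly p A))"
    using quadratic_form_infimum[OF self_adjoint_op_poly[OF A] \<open>x0 \<noteq> 0\<close>] by blast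
  have "op_poly (p - [:m:]) A = op_poly [:- m, 1:] (op_poly p A)"
    unfolding op_poly_diff by (intro blinfun_eqI) (simp add: blinfun.bilinear_simps)
  then have "p - [:m:] = 0 \<or> (\<exists>t\<in>real_spectrum A. poly (p - [:m:]) t = 0)"
    using bounded_below_op_poly[OF A, of "p - [:m:]"] not_below by metis
  then have "\<exists>t\<in>real_spectrum A. poly p t = m"
    using s by auto
  then show thesis using that m by blast
qed

lemma op_poly_form_mono:
  assumes "self_adjoint A" and "\<And>t. t \<in> real_spectrum A \<Longrightarrow> poly p t \<le> poly q t"
  shows "Re (cinner (op_poly p A x) x) \<le> Re (cinner (op_poly q A x) x)"
proof (cases "x = 0")
  case False
  obtain t where t: "t \<in> real_spectrum A"
    and le: "poly (q - p) t * (norm x)\<^sup>2 \<le> Re (cinner (op_poly (q - p) A x) x)"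
    using op_poly_form_lower_bound[OF assms(1) False] by metis
  have "0 \<le> poly (q - p) t * (norm x)\<^sup>2"
    using assms(2)[OF t] by simp
  with le show ?thesis
    by (simp add: op_poly_diff blinfun.diff_left cinner_diff_left)
qed simp

text \<open>The form of the square of \<open>p(A)\<close> is the square of
  \<open>norm (op_poly p A x)\<close>, so it suffices to compare \<open>p * p\<close> with the
  constant \<open>e\<^sup>2\<close>. Uniform convergence on the spectrum thus becomes norm
  convergence.\<close>

lemma norm_op_poly_le:
  assumes A: "self_adjoint A" and "0 \<le> e" and le: "\<And>t. t \<in> real_spectrum A \<Longrightarrow> \<bar>poly p t\<bar> \<le> e"
  shows "norm (op_poly p A) \<le> e"
proof (rule norm_blinfun_bound[OF \<open>0 \<le> e\<close>])
  fix x
  have "Re (cinner (op_poly (p * p) A x) x) \<le> Re (cinner (op_poly [:e\<^sup>2:] A x) x)"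
  proof (rule op_poly_form_mono[OF A])
    show "poly (p * p) t \<le> poly [:e\<^sup>2:] t" if "t \<in> real_spectrum A" for t
      using power_mono[OF le[OF that] abs_ge_zero, of 2] by (simp add: power2_eq_square)
  qed
  moreover have "cinner (op_poly (p * p) A x) x = of_real ((norm (op_poly p A x))\<^sup>2)"
    by (simp only: op_poly_mult blinfun_apply_blinfun_compose
        cinner_self_adjoint_square[OF self_adjoint_op_poly[OF A]])
  moreover have "cinner (op_poly [:e\<^sup>2:] A x) x = of_real (e\<^sup>2 * (norm x)\<^sup>2)"
    by (simp add: blinfun.scaleR_left cinner_scaleR_left cinner_self del: of_real_power)
  ultimately have "(norm (op_poly p A x))\<^sup>2 \<le> e\<^sup>2 * (norm x)\<^sup>2"
    by (simp only: Re_complex_of_real)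
  then have "(norm (op_poly p A x))\<^sup>2 \<le> (e * norm x)\<^sup>2"
    by (simp only: power_mult_distrib)
  then show "norm (op_poly p A x) \<le> e * norm x"
    by (rule power2_le_imp_le) (intro mult_nonneg_nonneg \<open>0 \<le> e\<close> norm_ge_zero)
qed

subsection \<open>The continuous functional calculus of a positive operator\<close>

definition positive_op :: "('a::chilbert_space \<Rightarrow>\<^sub>L 'a) \<Rightarrow> bool" where
  "positive_op A \<longleftrightarrow> self_adjoint A \<and> (\<forall>x. 0 \<le> Re (cinner (blinfun_apply A x) x))"

lemma positive_op_self_adjoint: "positive_op A \<Longrightarrow> self_adjoint A"
  by (simp add: positive_op_def)

text \<open>This compact interval stands in for the spectrum when functions are approximated by
  polynomials or bounded.\<close>

lemma real_spectrum_positive_op: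
  assumes "positive_op A"
  shows "real_spectrum A \<subseteq> {0..norm A}"
proof
  fix t assume t: "t \<in> real_spectrum A"
  have "0 \<le> t"
    using assms t by (intro real_spectrum_nonneg[of A t]) (simp_all add: positive_op_def)
  moreover have "\<bar>t\<bar> \<le> norm A"
    by (rule real_spectrum_le_norm[OF positive_op_self_adjoint[OF assms] t])
  ultimately show "t \<in> {0..norm A}" by simp
qed

text \<open>With \<open>q = p\<close> this is the Cauchy property; with different sequences it shows
  that the limit does not depend on the approximation.\<close>

lemma op_poly_uniform_limits_close:
  fixes p q :: "nat \<Rightarrow> real poly"
  assumes A: "self_adjoint A" and "e > 0"
    and "uniform_limit (real_spectrum A) (\<lambda>n. poly (p n)) f sequentially"
    and "uniform_limit (real_spectrum A) (\<lambda>n. poly (q n)) f sequentially"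
  shows "\<exists>N. \<forall>m\<ge>N. \<forall>n\<ge>N. norm (op_poly (p m) A - op_poly (q n) A) \<le> e"
proof -
  have "e / 2 > 0" using \<open>e > 0\<close> by simp
  then obtain N1 N2 where
    N1: "\<And>n t. n \<ge> N1 \<Longrightarrow> t \<in> real_spectrum A \<Longrightarrow> dist (poly (p n) t) (f t) < e / 2" and
    N2: "\<And>n t. n \<ge> N2 \<Longrightarrow> t \<in> real_spectrum A \<Longrightarrow> dist (poly (q n) t) (f t) < e / 2"
    using assms(3,4) unfolding uniform_limit_sequentially_iff by meson
  have "norm (op_poly (p m) A - op_poly (q n) A) \<le> e" if "m \<ge> max N1 N2" "n \<ge> max N1 N2" for m n
  proof -
    have mn: "m \<ge> N1" "n \<ge> N2" using that by auto
    have "\<bar>poly (p m - q n) t\<bar> \<le> e" if t: "t \<in> real_spectrum A" for t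
      using N1[OF mn(1) t] N2[OF mn(2) t] unfolding dist_real_def poly_diff by linarith
    then have "norm (op_poly (p m - q n) A) \<le> e"
      using \<open>e > 0\<close> by (intro norm_op_poly_le[OF A]) auto
    then show ?thesis by (simp add: op_poly_diff)
  qed
  then show ?thesis by blast
qed

text \<open>Justifies the definite description in \<open>cfc\<close>: every approximating sequence
  yields the same limit, and the given \<open>p\<close> guarantees that there is one, which makes
  that limit unique.\<close>

lemma cfc_limit:
  fixes p :: "nat \<Rightarrow> real poly"
  assumes A: "self_adjoint A"
    and p: "uniform_limit (real_spectrum A) (\<lambda>n. poly (p n)) f sequentially"
  shows "(\<lambda>n. op_poly (p n) A) \<longlonglongrightarrow> cfc f A"
proof -
  have "Cauchy (\<lambda>n. op_poly (p n) A)"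
  proof (rule metric_CauchyI)
    fix e :: real assume "e > 0"
    then have "e / 2 > 0" by simp
    from op_poly_uniform_limits_close[OF A this p p] obtain N where
      N: "\<And>m n. m \<ge> N \<Longrightarrow> n \<ge> N \<Longrightarrow> norm (op_poly (p m) A - op_poly (p n) A) \<le> e / 2" by blast
    have "dist (op_poly (p m) A) (op_poly (p n) A) < e" if "m \<ge> N" "n \<ge> N" for m n
      using N[OF that] \<open>e > 0\<close> by (simp add: dist_norm)
    then show "\<exists>M. \<forall>m\<ge>M. \<forall>n\<ge>M. dist (op_poly (p m) A) (op_poly (p n) A) < e" by blast
  qed
  then obtain B where B: "(\<lambda>n. op_poly (p n) A) \<longlonglongrightarrow> B"
    using Cauchy_convergent_iff convergent_def by blast
  have lim: "(\<lambda>n. op_poly (q n) A) \<longlonglongrightarrow> B"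
    if q: "uniform_limit (real_spectrum A) (\<lambda>n. poly (q n)) f sequentially" for q
  proof -
    have "(\<lambda>n. op_poly (q n) A - op_poly (p n) A) \<longlonglongrightarrow> 0"
    proof (rule LIMSEQ_I)
      fix e :: real assume "e > 0"
      then have "e / 2 > 0" by simp
      from op_poly_uniform_limits_close[OF A this q p] obtain N where
        N: "\<forall>m\<ge>N. \<forall>n\<ge>N. norm (op_poly (q m) A - op_poly (p n) A) \<le> e / 2" by blast
      have "norm (op_poly (q n) A - op_poly (p n) A - 0) < e" if "n \<ge> N" for n
        using N[rule_format, OF that that] \<open>e > 0\<close> by simp
      then show "\<exists>N. \<forall>n\<ge>N. norm (op_poly (q n) A - op_poly (p n) A - 0) < e" by blast
    qed
    from tendsto_add[OF this B] show ?thesis by simp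
  qed
  have "cfc f A = B"
    unfolding cfc_def
  proof (rule the_equality)
    show "\<forall>q. uniform_limit (real_spectrum A) (\<lambda>n. poly (q n)) f sequentially
        \<longrightarrow> (\<lambda>n. op_poly (q n) A) \<longlonglongrightarrow> B"
      using lim by blast
    show "B' = B" if "\<forall>q. uniform_limit (real_spectrum A) (\<lambda>n. poly (q n)) f sequentially
        \<longrightarrow> (\<lambda>n. op_poly (q n) A) \<longlonglongrightarrow> B'" for B'
      using LIMSEQ_unique[OF _ B] that p by blast
  qed
  with B show ?thesis by simp
qed

lemma cfc_poly: "self_adjoint A \<Longrightarrow> cfc (poly p) A = op_poly p A"
  using cfc_limit[of A "\<lambda>_. p", OF _ uniform_limit_const] by (simp add: LIMSEQ_const_iff)

lemma cfc_cong:
  assumes "\<And>t. t \<in> real_spectrum A \<Longrightarrow> f t = g t"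
  shows "cfc f A = cfc g A"
proof -
  have "uniform_limit (real_spectrum A) (\<lambda>n. poly (p n)) f sequentially
      \<longleftrightarrow> uniform_limit (real_spectrum A) (\<lambda>n. poly (p n)) g sequentially" for p :: "nat \<Rightarrow> real poly"
    by (intro uniform_limit_cong' assms refl)
  then show ?thesis by (simp only: cfc_def)
qed

lemma polynomials_uniform_limit:
  fixes f :: "real \<Rightarrow> real"
  assumes "compact S" "continuous_on S f"
  obtains p where "uniform_limit S (\<lambda>n. poly (p n)) f sequentially"
proof -
  have "\<exists>p. \<forall>x\<in>S. \<bar>f x - poly p x\<bar> < inverse (Suc n)" for n
  proof -
    obtain g where "real_polynomial_function g" and g: "\<And>x. x \<in> S \<Longrightarrow> \<bar>f x - g x\<bar> < inverse (Suc n)"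
      using Stone_Weierstrass_real_polynomial_function[OF assms, of "inverse (Suc n)"] by auto
    then obtain a k where "g = (\<lambda>x. \<Sum>i\<le>k. a i * x ^ i)"
      using real_polynomial_function_iff_sum by blast
    then have "g = poly (\<Sum>i\<le>k. monom (a i) i)"
      by (simp add: fun_eq_iff poly_sum poly_monom)
    with g show ?thesis by blast
  qed
  then obtain p where p: "\<And>n x. x \<in> S \<Longrightarrow> \<bar>f x - poly (p n) x\<bar> < inverse (Suc n)"
    by metis
  have "uniform_limit S (\<lambda>n. poly (p n)) f sequentially"
    unfolding uniform_limit_sequentially_iff
  proof (intro allI impI)
    fix e :: real assume "e > 0"
    then obtain N where N: "inverse (Suc N) < e" using reals_Archimedean by blast
    have "dist (poly (p n) x) (f x) < e" if "n \<ge> N" "x \<in> S" for n x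
    proof -
      have "inverse (real (Suc n)) \<le> inverse (real (Suc N))"
        using \<open>n \<ge> N\<close> by (intro le_imp_inverse_le) auto
      with p[OF \<open>x \<in> S\<close>, of n] N show ?thesis
        unfolding dist_real_def by linarith
    qed
    then show "\<exists>N. \<forall>n\<ge>N. \<forall>x\<in>S. dist (poly (p n) x) (f x) < e" by blast
  qed
  then show thesis by (rule that)
qed

lemma cfc_approximation:
  assumes A: "positive_op A" and f: "continuous_on {0..} f"
  obtains p where "uniform_limit (real_spectrum A) (\<lambda>n. poly (p n)) f sequentially"
    "(\<lambda>n. op_poly (p n) A) \<longlonglongrightarrow> cfc f A"
proof -
  have "continuous_on {0..norm A} f"
    by (rule continuous_on_subset[OF f]) auto
  then obtain p where p: "uniform_limit {0..norm A} (\<lambda>n. poly (p n)) f sequentially"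
    using polynomials_uniform_limit[OF compact_Icc] by blast
  then have *: "uniform_limit (real_spectrum A) (\<lambda>n. poly (p n)) f sequentially"
    by (rule uniform_limit_on_subset) (rule real_spectrum_positive_op[OF A])
  from * cfc_limit[OF positive_op_self_adjoint[OF A] *] show thesis by (rule that)
qed

lemma self_adjoint_cfc:
  assumes "positive_op A" "continuous_on {0..} f"
  shows "self_adjoint (cfc f A)"
proof -
  obtain p where "(\<lambda>n. op_poly (p n) A) \<longlonglongrightarrow> cfc f A"
    using cfc_approximation[OF assms] by blast
  then show ?thesis
    by (rule self_adjoint_limit[rotated]) (intro self_adjoint_op_poly positive_op_self_adjoint assms)
qed

text \<open>Products of the approximants converge uniformly because \<open>f\<close> and
  \<open>g\<close> are bounded on the spectrum, and composition is continuous in the norm.\<close>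

lemma cfc_mult:
  assumes A: "positive_op A" and f: "continuous_on {0..} f" and g: "continuous_on {0..} g"
  shows "cfc f A o\<^sub>L cfc g A = cfc (\<lambda>t. f t * g t) A"
proof -
  obtain p where p: "uniform_limit (real_spectrum A) (\<lambda>n. poly (p n)) f sequentially"
    "(\<lambda>n. op_poly (p n) A) \<longlonglongrightarrow> cfc f A"
    using cfc_approximation[OF A f] by blast
  obtain q where q: "uniform_limit (real_spectrum A) (\<lambda>n. poly (q n)) g sequentially"
    "(\<lambda>n. op_poly (q n) A) \<longlonglongrightarrow> cfc g A"
    using cfc_approximation[OF A g] by blast
  have bounded: "bounded (h ` real_spectrum A)" if "continuous_on {0..} h" for h :: "real \<Rightarrow> real"
  proof (rule bounded_subset)
    show "bounded (h ` {0..norm A})"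
      by (intro compact_imp_bounded compact_continuous_image continuous_on_subset[OF that]) auto
    show "h ` real_spectrum A \<subseteq> h ` {0..norm A}"
      by (intro image_mono real_spectrum_positive_op[OF A])
  qed
  have "uniform_limit (real_spectrum A) (\<lambda>n. poly (p n * q n)) (\<lambda>t. f t * g t) sequentially"
    using uniform_lim_mult[OF p(1) q(1) bounded[OF f] bounded[OF g]] by (simp add: poly_mult[abs_def])
  from cfc_limit[OF positive_op_self_adjoint[OF A] this]
  have "(\<lambda>n. op_poly (p n) A o\<^sub>L op_poly (q n) A) \<longlonglongrightarrow> cfc (\<lambda>t. f t * g t) A"
    by (simp add: op_poly_mult)
  moreover have "(\<lambda>n. op_poly (p n) A o\<^sub>L op_poly (q n) A) \<longlonglongrightarrow> (cfc f A o\<^sub>L cfc g A)"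
    by (intro bounded_bilinear.tendsto[OF bounded_bilinear_blinfun_compose] p q)
  ultimately show ?thesis
    using LIMSEQ_unique by blast
qed

text \<open>Once \<open>p n\<close> is uniformly within \<open>e\<close> of \<open>f\<close>, the
  polynomial \<open>p n + e\<close> dominates \<open>q\<close> on the spectrum. It is used with
  \<open>q = 0\<close> for positivity of powers and with a tangent for McCarthy's
  inequality.\<close>

lemma cfc_form_lower_bound:
  assumes A: "positive_op A" and f: "continuous_on {0..} f" and le: "\<And>t. t \<ge> 0 \<Longrightarrow> poly q t \<le> f t"
  shows "Re (cinner (op_poly q A x) x) \<le> Re (cinner (cfc f A x) x)"
proof -
  obtain p where p: "uniform_limit (real_spectrum A) (\<lambda>n. poly (p n)) f sequentially"
    and lim: "(\<lambda>n. op_poly (p n) A) \<longlonglongrightarrow> cfc f A"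
    using cfc_approximation[OF A f] by blast
  have form_lim: "(\<lambda>n. Re (cinner (op_poly (p n) A x) x)) \<longlonglongrightarrow> Re (cinner (cfc f A x) x)"
    by (intro tendsto_Re bounded_linear.tendsto[OF bounded_linear_cinner_left] blinfun.tendsto
        lim tendsto_const)
  have approx: "Re (cinner (op_poly q A x) x) \<le> Re (cinner (cfc f A x) x) + e * (norm x)\<^sup>2" if "e > 0" for e
  proof -
    obtain N where N: "\<And>n t. n \<ge> N \<Longrightarrow> t \<in> real_spectrum A \<Longrightarrow> dist (poly (p n) t) (f t) < e"
      using p \<open>e > 0\<close> unfolding uniform_limit_sequentially_iff by meson
    have "Re (cinner (op_poly q A x) x) \<le> Re (cinner (op_poly (p n) A x) x) + e * (norm x)\<^sup>2"
      if "n \<ge> N" for n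
    proof -
      have "Re (cinner (op_poly q A x) x) \<le> Re (cinner (op_poly (p n + [:e:]) A x) x)"
      proof (rule op_poly_form_mono[OF positive_op_self_adjoint[OF A]])
        fix t assume t: "t \<in> real_spectrum A"
        then have "t \<ge> 0" using real_spectrum_positive_op[OF A] by auto
        then show "poly q t \<le> poly (p n + [:e:]) t"
          using N[OF that t] le[of t] by (simp add: dist_real_def)
      qed
      then show ?thesis
        by (simp add: op_poly_add blinfun.bilinear_simps cinner_algebra cinner_self flip: of_real_power)
    qed
    then show ?thesis
      by (intro Lim_bounded2[OF tendsto_add[OF form_lim tendsto_const]]) blast
  qed
  show ?thesis
  proof (rule field_le_epsilon)
    fix d :: real assume "d > 0"
    define e where "e = d / ((norm x)\<^sup>2 + 1)"
    have "(norm x)\<^sup>2 + 1 > 0" by (simp add: add_nonneg_pos)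
    then have "e > 0" using \<open>d > 0\<close> by (simp add: e_def)
    have "e * (norm x)\<^sup>2 \<le> e * ((norm x)\<^sup>2 + 1)"
      using \<open>e > 0\<close> by (intro mult_left_mono) auto
    also have "\<dots> = d" using \<open>(norm x)\<^sup>2 + 1 > 0\<close> by (simp add: e_def)
    finally show "Re (cinner (op_poly q A x) x) \<le> Re (cinner (cfc f A x) x) + d"
      using approx[OF \<open>e > 0\<close>] by linarith
  qed
qed

subsection \<open>Powers and the absolute value\<close>

lemma continuous_on_powr_nonneg: "s > 0 \<Longrightarrow> continuous_on {0..} (\<lambda>t::real. t powr s)"
  by (intro continuous_on_powr' continuous_on_id continuous_on_const) auto

lemma op_powr_add:
  assumes "positive_op A" "s > 0" "t > 0"
  shows "op_powr A s o\<^sub>L op_powr A t = op_powr A (s + t)"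
  using assms by (simp add: op_powr_def cfc_mult continuous_on_powr_nonneg powr_add)

text \<open>\<open>t powr 1\<close> equals \<open>t\<close> only for nonnegative \<open>t\<close>,
  hence the restriction to the spectrum.\<close>

lemma op_powr_one:
  assumes "positive_op A"
  shows "op_powr A 1 = A"
proof -
  have "op_powr A 1 = cfc (poly [:0, 1:]) A"
    unfolding op_powr_def using real_spectrum_positive_op[OF assms] by (intro cfc_cong) auto
  also have "\<dots> = A o\<^sub>L id_blinfun"
    using assms by (simp add: cfc_poly positive_op_self_adjoint)
  also have "\<dots> = A" by (intro blinfun_eqI) simp
  finally show ?thesis .
qed

lemma positive_op_powr:
  assumes "positive_op A" "s > 0"
  shows "positive_op (op_powr A s)"
  unfolding positive_op_def
proof (intro conjI allI)
  show "self_adjoint (op_powr A s)"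
    unfolding op_powr_def by (intro self_adjoint_cfc assms continuous_on_powr_nonneg)
  show "0 \<le> Re (cinner (op_powr A s x) x)" for x
    using cfc_form_lower_bound[OF assms(1) continuous_on_powr_nonneg[OF assms(2)], of 0 x]
    by (simp add: op_powr_def)
qed

text \<open>The graph of the convex power lies above its tangent at \<open>l\<close>. Scaling by
  \<open>l\<close> reduces this to Bernoulli's inequality, which is Young's inequality for
  \<open>v\<close> and 1 with exponents \<open>r\<close> and \<open>r / (r - 1)\<close>.\<close>

lemma powr_ge_tangent:
  fixes u l r :: real
  assumes "r \<ge> 1" "u \<ge> 0" "l > 0"
  shows "r * l powr (r - 1) * u - (r - 1) * l powr r \<le> u powr r"
proof -
  have Bernoulli: "r * v - (r - 1) \<le> v powr r" if "v \<ge> 0" for v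
  proof (cases "r = 1")
    case False
    then have "r > 1" using assms by simp
    then have "v * 1 \<le> v powr r / r + 1 powr (r / (r - 1)) / (r / (r - 1))"
      using that by (intro Youngs_inequality) (auto simp: field_simps)
    then have "v \<le> (v powr r + (r - 1)) / r"
      by (simp add: add_divide_distrib)
    then show ?thesis using \<open>r > 1\<close> by (simp add: pos_le_divide_eq mult.commute)
  qed (use that in simp)
  have "l powr r * (r * (u / l) - (r - 1)) \<le> l powr r * (u / l) powr r"
    using assms by (intro mult_left_mono Bernoulli) auto
  also have "\<dots> = u powr r"
    using assms by (simp add: powr_divide)
  also have "l powr r * (r * (u / l) - (r - 1)) = r * l powr (r - 1) * u - (r - 1) * l powr r"
    using assms by (simp add: powr_diff field_simps)
  finally show ?thesis .
qed

text \<open>Adding the tangent inequalities at the midpoint \<open>l\<close> for \<open>a\<close>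
  and \<open>b\<close>, the linear terms combine to \<open>2 * l powr s\<close>.\<close>

lemma powr_mean_le:
  fixes a b s :: real
  assumes "s \<ge> 1" "a \<ge> 0" "b \<ge> 0"
  shows "((a + b) / 2) powr s \<le> (a powr s + b powr s) / 2"
proof (cases "a + b = 0")
  case True
  then show ?thesis using assms by simp
next
  case False
  define l where "l = (a + b) / 2"
  have "l > 0" using False assms by (simp add: l_def)
  have "r * l powr (r - 1) * a - (r - 1) * l powr r + (r * l powr (r - 1) * b - (r - 1) * l powr r)
      = 2 * l powr r" for r
  proof -
    have "r * l powr (r - 1) * a + r * l powr (r - 1) * b = 2 * r * (l powr (r - 1) * l)"
      by (simp add: l_def algebra_simps)
    also have "l powr (r - 1) * l = l powr r"
      using \<open>l > 0\<close> by (simp add: powr_diff)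
    finally show ?thesis by (simp add: algebra_simps)
  qed
  from this[of s] show ?thesis
    using powr_ge_tangent[OF assms(1,2) \<open>l > 0\<close>] powr_ge_tangent[OF assms(1,3) \<open>l > 0\<close>]
    by (simp add: l_def)
qed

text \<open>McCarthy's inequality for \<open>A\<^sup>2\<close>, from the tangent to \<open>u \<mapsto> u powr r\<close> at \<open>\<parallel>Ax\<parallel>\<^sup>2 = \<langle>A\<^sup>2x, x\<rangle>\<close>.\<close>

lemma norm_powr_le_op_powr_form:
  assumes A: "positive_op A" and "r \<ge> 1" and "norm x = 1"
  shows "norm (A x) powr (2 * r) \<le> Re (cinner (op_powr A (2 * r) x) x)"
proof (cases "A x = 0")
  case True
  then show ?thesis
    using positive_op_powr[OF A, of "2 * r"] \<open>r \<ge> 1\<close> by (simp add: positive_op_def)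
next
  case False
  define l where "l = (norm (A x))\<^sup>2"
  have "l > 0" using False by (simp add: l_def)
  \<comment> \<open>The tangent at \<open>l\<close>, evaluated at the square of the variable; its
    form at \<open>x\<close> is the tangent at its point of contact.\<close>
  define q where "q = [:- ((r - 1) * l powr r), 0, r * l powr (r - 1):]"
  have "Re (cinner (op_poly q A x) x) = r * l powr (r - 1) * l - (r - 1) * l powr r"
  proof -
    have "op_poly q A x = (r * l powr (r - 1)) *\<^sub>R A (A x) - ((r - 1) * l powr r) *\<^sub>R x"
      by (simp add: q_def blinfun.bilinear_simps)
    then show ?thesis
      using cinner_self_adjoint_square[OF positive_op_self_adjoint[OF A], of x] \<open>norm x = 1\<close>
      by (simp add: cinner_algebra cinner_self l_def del: of_real_power)
  qed
  also have "\<dots> = l powr r"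
    using \<open>l > 0\<close> by (simp add: powr_diff algebra_simps)
  also have "\<dots> = norm (A x) powr (2 * r)"
    using False by (simp add: l_def powr_powr flip: powr_numeral)
  finally have "norm (A x) powr (2 * r) = Re (cinner (op_poly q A x) x)" by simp
  also have "\<dots> \<le> Re (cinner (cfc (\<lambda>t. t powr (2 * r)) A x) x)"
  proof (rule cfc_form_lower_bound[OF A])
    show "continuous_on {0..} (\<lambda>t. t powr (2 * r))"
      using \<open>r \<ge> 1\<close> by (intro continuous_on_powr_nonneg) simp
    fix t :: real assume "t \<ge> 0"
    have "(t\<^sup>2) powr r = t powr (2 * r)"
      using \<open>t \<ge> 0\<close> by (cases "t = 0") (simp_all add: powr_powr flip: powr_numeral)
    then show "poly q t \<le> t powr (2 * r)"
      using powr_ge_tangent[OF \<open>r \<ge> 1\<close> _ \<open>l > 0\<close>, of "t\<^sup>2"]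
      by (simp add: q_def power2_eq_square algebra_simps)
  qed
  finally show ?thesis by (simp add: op_powr_def)
qed

section \<open>The absolute value of an operator\<close>

lemma positive_op_adj_compose:
  assumes "S \<in> bounded_ops"
  shows "positive_op (adj S o\<^sub>L S)"
proof -
  have right: "cinner x (adj S (S y)) = cinner (S x) (S y)" for x y
    by (simp add: cinner_adj_right[OF assms])
  have left: "cinner (adj S (S x)) y = cinner (S x) (S y)" for x y
    using right[of y x] cinner_commute by metis
  show ?thesis
    using assms adj_in_bounded_ops[OF assms]
    by (simp add: positive_op_def self_adjoint_def bounded_ops_def left right cinner_ge_zero)
qed

lemma positive_op_abs: "S \<in> bounded_ops \<Longrightarrow> positive_op (op_abs S)"
  unfolding op_abs_def by (intro positive_op_powr positive_op_adj_compose) auto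

text \<open>The exponents 1/2 and 1/2 add to 1, so the square of \<open>op_abs S\<close> is
  \<open>adj S o\<^sub>L S\<close>. This lets McCarthy's inequality for \<open>op_abs S\<close>
  speak of \<open>norm (S x)\<close>.\<close>

lemma norm_op_abs_apply:
  assumes "S \<in> bounded_ops"
  shows "norm (op_abs S x) = norm (S x)"
proof -
  have "op_abs S o\<^sub>L op_abs S = adj S o\<^sub>L S"
    unfolding op_abs_def by (simp add: op_powr_add op_powr_one positive_op_adj_compose assms)
  then have "op_abs S (op_abs S x) = adj S (S x)"
    by (metis blinfun_apply_blinfun_compose)
  then have "cinner x (op_abs S (op_abs S x)) = cinner (S x) (S x)"
    by (simp add: cinner_adj_right[OF assms])
  then have "cinner (op_abs S x) (op_abs S x) = cinner (S x) (S x)"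
    by (simp add: self_adjointD[OF positive_op_self_adjoint[OF positive_op_abs[OF assms]]])
  then show ?thesis by (simp add: norm_eq_sqrt_cinner)
qed

subsection \<open>The numerical radius\<close>

lemma num_radius_bdd: "bdd_above (insert 0 {cmod (cinner (blinfun_apply T x) x) | x. norm x = 1})"
proof -
  have "cmod (cinner (T x) x) \<le> norm T" if "norm x = 1" for x
    using cinner_cauchy_schwarz[of "T x" x] norm_blinfun[of T x] that by simp
  then show ?thesis by (auto intro!: bdd_aboveI[where M = "norm T"])
qed

lemma num_radius_nonneg: "0 \<le> num_radius T"
  unfolding num_radius_def by (rule cSup_upper[OF insertI1 num_radius_bdd])

lemma cmod_form_le_num_radius: "norm x = 1 \<Longrightarrow> cmod (cinner (blinfun_apply T x) x) \<le> num_radius T"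
  unfolding num_radius_def by (rule cSup_upper[OF _ num_radius_bdd]) auto

text \<open>The root of order \<open>s\<close> is taken before passing to the supremum and undone
  afterwards; \<open>b \<ge> 0\<close> covers the value 0 inserted into the supremum.\<close>

lemma num_radius_powr_le:
  assumes "s > 0" "b \<ge> 0" "\<And>x. norm x = 1 \<Longrightarrow> cmod (cinner (blinfun_apply T x) x) powr s \<le> b"
  shows "num_radius T powr s \<le> b"
proof -
  have "cmod (cinner (T x) x) \<le> b powr (1 / s)" if "norm x = 1" for x
  proof -
    have "(cmod (cinner (T x) x) powr s) powr (1 / s) \<le> b powr (1 / s)"
      using assms(1) assms(3)[OF that] by (intro powr_mono2) auto
    then show ?thesis using assms(1) by (simp add: powr_powr)
  qed
  then have "num_radius T \<le> b powr (1 / s)"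
    unfolding num_radius_def by (intro cSup_least) auto
  then have "num_radius T powr s \<le> (b powr (1 / s)) powr s"
    using assms(1) num_radius_nonneg by (intro powr_mono2) auto
  then show ?thesis using assms(1,2) by (simp add: powr_powr)
qed

lemma num_radius_le:
  assumes "b \<ge> 0" "\<And>x. norm x = 1 \<Longrightarrow> cmod (cinner (blinfun_apply T x) x) \<le> b"
  shows "num_radius T \<le> b"
  using num_radius_powr_le[of 1 b T] assms num_radius_nonneg[of T] by simp

lemma Re_form_le_norm:
  assumes "norm x = 1"
  shows "Re (cinner (blinfun_apply T x) x) \<le> norm T"
proof -
  have "Re (cinner (T x) x) \<le> norm (T x) * norm x"
    by (rule order_trans[OF complex_Re_le_cmod cinner_cauchy_schwarz])
  then show ?thesis using norm_blinfun[of T x] assms by simp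
qed

subsection \<open>The numerical radius inequality\<close>

lemma powr_powr_half: "0 \<le> a \<Longrightarrow> a\<^sup>2 powr s = a powr (2 * s)" for a s :: real
  by (cases "a = 0") (simp_all add: powr_powr flip: powr_numeral)

lemma powr_double: "a powr (2 * s) = (a powr s)\<^sup>2" for a s :: real
  unfolding mult_2 powr_add power2_eq_square ..

lemma mult_le_half_sum_squares: "x * y \<le> (x\<^sup>2 + y\<^sup>2) / 2" for x y :: real
  using sum_squares_bound[of x y] by simp

text \<open>Buzano's and the Cauchy-Schwarz inequality for \<open>T x\<close> and
  \<open>adj T x\<close>, whose inner product is the form of \<open>T o\<^sub>L T\<close> at
  \<open>x\<close>.\<close>

lemma
  fixes x :: "'a::chilbert_space"
  assumes "T \<in> bounded_ops" "norm x = 1"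
  shows cmod_form_sq_le: "(cmod (cinner (blinfun_apply T x) x))\<^sup>2
      \<le> (norm (T x) * norm (adj T x) + cmod (cinner ((T o\<^sub>L T) x) x)) / 2"
    and cmod_form_compose_le: "cmod (cinner ((T o\<^sub>L T) x) x) \<le> norm (T x) * norm (adj T x)"
proof -
  have eq: "cinner ((T o\<^sub>L T) x) x = cinner (T x) (adj T x)"
    by (simp add: cinner_adj_right[OF assms(1)])
  have "cinner x (adj T x) = cinner (T x) x"
    by (simp add: cinner_adj_right[OF assms(1)])
  then show "(cmod (cinner (blinfun_apply T x) x))\<^sup>2
      \<le> (norm (T x) * norm (adj T x) + cmod (cinner ((T o\<^sub>L T) x) x)) / 2"
    using buzano[OF assms(2), of "T x" "adj T x"] by (simp only: eq power2_eq_square)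
  show "cmod (cinner ((T o\<^sub>L T) x) x) \<le> norm (T x) * norm (adj T x)"
    unfolding eq by (rule cinner_cauchy_schwarz)
qed

text \<open>The form of \<open>(C o\<^sub>L C) + (D o\<^sub>L D)\<close> is the sum of the squared
  norms of \<open>C x\<close> and \<open>D x\<close>. The parallelogram law, keeping only the sum
  term, then bounds \<open>C + D\<close>.\<close>

lemma
  assumes "self_adjoint C" "self_adjoint D"
  shows norm_sq_add_le: "norm x = 1 \<Longrightarrow>
      (norm (blinfun_apply C x))\<^sup>2 + (norm (blinfun_apply D x))\<^sup>2 \<le> norm ((C o\<^sub>L C) + (D o\<^sub>L D))"
    and norm_add_sq_le: "(norm (C + D))\<^sup>2 \<le> 2 * norm ((C o\<^sub>L C) + (D o\<^sub>L D))"
proof -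
  let ?E = "(C o\<^sub>L C) + (D o\<^sub>L D)"
  have form: "Re (cinner (?E x) x) = (norm (C x))\<^sup>2 + (norm (D x))\<^sup>2" for x
    by (simp add: blinfun.add_left cinner_add_left cinner_self_adjoint_square assms
        del: of_real_power)
  show "(norm (C x))\<^sup>2 + (norm (D x))\<^sup>2 \<le> norm ?E" if "norm x = 1" for x
    using Re_form_le_norm[OF that, of ?E] form by simp
  have "norm (C + D) \<le> sqrt (2 * norm ?E)"
  proof (rule norm_blinfun_bound)
    fix x
    have "(norm ((C + D) x))\<^sup>2 \<le> (norm (C x + D x))\<^sup>2 + (norm (C x - D x))\<^sup>2"
      by (simp add: blinfun.add_left)
    also have "\<dots> = 2 * ((norm (C x))\<^sup>2 + (norm (D x))\<^sup>2)"
      by (simp only: parallelogram_law distrib_left)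
    also have "\<dots> \<le> 2 * (norm (?E x) * norm x)"
      unfolding form[symmetric]
      by (intro mult_left_mono order_trans[OF complex_Re_le_cmod cinner_cauchy_schwarz]) auto
    also have "\<dots> \<le> 2 * ((norm ?E * norm x) * norm x)"
      by (intro mult_left_mono mult_right_mono norm_blinfun) auto
    also have "\<dots> = (sqrt (2 * norm ?E) * norm x)\<^sup>2"
      by (simp add: power_mult_distrib power2_eq_square)
    finally show "norm ((C + D) x) \<le> sqrt (2 * norm ?E) * norm x"
      by (rule power2_le_imp_le) simp
  qed simp
  then have "(norm (C + D))\<^sup>2 \<le> (sqrt (2 * norm ?E))\<^sup>2"
    by (intro power_mono) auto
  then show "(norm (C + D))\<^sup>2 \<le> 2 * norm ?E" by simp
qed

theorem theorem2p13:
  fixes T :: "'a::chilbert_space \<Rightarrow>\<^sub>L 'a" and \<alpha> r :: real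
  assumes "T \<in> bounded_ops"
    and "0 \<le> \<alpha>" and "\<alpha> \<le> 1" and "1 \<le> r"
  shows "let A = op_abs T; B = op_abs (adj T); w = num_radius;
           M = \<alpha> / 8 * norm (op_powr A (4 * r) + op_powr B (4 * r))
             + \<alpha> / 4 * w (op_powr B (2 * r) o\<^sub>L op_powr A (2 * r))
             + \<alpha> / 2 * w (T o\<^sub>L T) powr (2 * r)
             + (1 - \<alpha>) / 4 * norm (op_powr A (2 * r) + op_powr B (2 * r)) * w T powr (2 * r)
             + (1 - \<alpha>) / 2 * w (T o\<^sub>L T) powr r * w T powr (2 * r)
         in w T powr (4 * r) \<le> M
            \<and> M \<le> 1 / 2 * norm (op_powr A (4 * r) + op_powr B (4 * r))"
proof -
  note T = assms(1)
  define C where "C = op_powr (op_abs T) (2 * r)"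
  define D where "D = op_powr (op_abs (adj T)) (2 * r)"
  have pos: "positive_op (op_abs T)" "positive_op (op_abs (adj T))"
    using T by (auto intro: positive_op_abs adj_in_bounded_ops)
  have C: "self_adjoint C" and D: "self_adjoint D"
    unfolding C_def D_def using \<open>1 \<le> r\<close> pos by (auto intro!: positive_op_self_adjoint positive_op_powr)
  \<comment> \<open>Since \<open>4 * r = 2 * r + 2 * r\<close>, the powers of order
    \<open>4 * r\<close> are squares of \<open>C\<close> and \<open>D\<close>, and everything
    reduces to these two self-adjoint operators.\<close>
  have CC: "op_powr (op_abs T) (4 * r) = C o\<^sub>L C" and DD: "op_powr (op_abs (adj T)) (4 * r) = D o\<^sub>L D"
    unfolding C_def D_def using \<open>1 \<le> r\<close> pos by (simp_all add: op_powr_add)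
  define E F where "E = norm ((C o\<^sub>L C) + (D o\<^sub>L D))" and "F = norm (C + D)"
  define w w2 v where "w = num_radius T" and "w2 = num_radius (T o\<^sub>L T)" and "v = num_radius (D o\<^sub>L C)"
  have nonneg: "0 \<le> E" "0 \<le> F" "0 \<le> w" "0 \<le> w2" "0 \<le> v"
    by (simp_all add: E_def F_def w_def w2_def v_def num_radius_nonneg)
  define ab where "ab x = norm (T x) * norm (adj T x)" for x
  have ab0: "0 \<le> ab x" for x by (simp add: ab_def)
  have formC: "norm (T x) powr (2 * r) \<le> Re (cinner (C x) x)"
    and formD: "norm (adj T x) powr (2 * r) \<le> Re (cinner (D x) x)" if "norm x = 1" for x
    unfolding C_def D_def
    using norm_powr_le_op_powr_form[OF pos(1) \<open>1 \<le> r\<close> that]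
      norm_powr_le_op_powr_form[OF pos(2) \<open>1 \<le> r\<close> that]
    by (simp_all add: norm_op_abs_apply T adj_in_bounded_ops)
  have abF: "ab x powr r \<le> F / 2" if "norm x = 1" for x
  proof -
    have "ab x powr r \<le> ((norm (T x) powr r)\<^sup>2 + (norm (adj T x) powr r)\<^sup>2) / 2"
      unfolding ab_def powr_mult by (rule mult_le_half_sum_squares)
    also have "\<dots> \<le> Re (cinner ((C + D) x) x) / 2"
      using formC[OF that] formD[OF that] by (simp add: powr_double blinfun.add_left cinner_add_left)
    also have "\<dots> \<le> F / 2"
      unfolding F_def by (intro divide_right_mono Re_form_le_norm that) simp
    finally show ?thesis .
  qed
  have ab_CD: "ab x powr (2 * r) \<le> cmod (cinner (C x) x) * cmod (cinner x (D x))" if "norm x = 1" for x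
  proof -
    have "ab x powr (2 * r) = norm (T x) powr (2 * r) * norm (adj T x) powr (2 * r)"
      by (simp add: ab_def powr_mult)
    also have "\<dots> \<le> cmod (cinner (C x) x) * cmod (cinner (D x) x)"
      by (intro mult_mono order_trans[OF formC[OF that] complex_Re_le_cmod]
          order_trans[OF formD[OF that] complex_Re_le_cmod]) auto
    finally show ?thesis by (simp add: self_adjointD[OF D])
  qed
  have CD_E: "norm (C x) * norm (D x) \<le> E / 2" if "norm x = 1" for x
    using mult_le_half_sum_squares[of "norm (C x)" "norm (D x)"] norm_sq_add_le[OF C D that]
    by (simp add: E_def)
  have DC_form: "cinner ((D o\<^sub>L C) x) x = cinner (C x) (D x)" for x
    by (simp add: self_adjointD[OF D])
  \<comment> \<open>The coarse bound by Cauchy-Schwarz, used for the second inequality of the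
    theorem; \<open>abEv\<close> refines it by Buzano's inequality for the first.\<close>
  have abE: "ab x powr (2 * r) \<le> E / 2" if "norm x = 1" for x
  proof -
    have "cmod (cinner (C x) x) * cmod (cinner x (D x)) \<le> norm (C x) * norm (D x)"
      using cinner_cauchy_schwarz[of "C x" x] cinner_cauchy_schwarz[of x "D x"] that
      by (intro mult_mono) auto
    with ab_CD[OF that] CD_E[OF that] show ?thesis by linarith
  qed
  have abEv: "ab x powr (2 * r) \<le> E / 4 + v / 2" if "norm x = 1" for x
  proof -
    have "cmod (cinner (C x) (D x)) \<le> v"
      unfolding v_def DC_form[symmetric] by (rule cmod_form_le_num_radius[OF that])
    then have "(norm (C x) * norm (D x) + cmod (cinner (C x) (D x))) / 2 \<le> (E / 2 + v) / 2"
      by (intro divide_right_mono add_mono CD_E[OF that]) auto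
    from order_trans[OF ab_CD[OF that] order_trans[OF buzano[OF that] this]]
    show ?thesis by simp
  qed
  have v_le: "v \<le> E / 2"
    unfolding v_def
  proof (rule num_radius_le)
    show "cmod (cinner ((D o\<^sub>L C) x) x) \<le> E / 2" if "norm x = 1" for x
      unfolding DC_form by (rule order_trans[OF cinner_cauchy_schwarz CD_E[OF that]])
  qed (use nonneg in simp)
  have w2_powr: "w2 powr s \<le> b" if "s > 0" "b \<ge> 0" "\<And>x. norm x = 1 \<Longrightarrow> ab x powr s \<le> b" for s b
    unfolding w2_def
  proof (rule num_radius_powr_le[OF that(1,2)])
    fix x :: 'a assume x: "norm x = 1"
    have "cmod (cinner ((T o\<^sub>L T) x) x) powr s \<le> ab x powr s"
      unfolding ab_def using that(1) by (intro powr_mono2 cmod_form_compose_le[OF T x]) auto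
    also have "\<dots> \<le> b" by (rule that(3)[OF x])
    finally show "cmod (cinner ((T o\<^sub>L T) x) x) powr s \<le> b" .
  qed
  \<comment> \<open>Buzano's bound for the squared form, raised to the power \<open>s\<close> by
    convexity. It is applied with \<open>s = r\<close>, \<open>b = F / 2\<close> and with
    \<open>s = 2 * r\<close>, \<open>b = E / 4 + v / 2\<close>.\<close>
  have w_powr: "w powr (2 * s) \<le> (b + w2 powr s) / 2"
    if "s \<ge> 1" "b \<ge> 0" "\<And>x. norm x = 1 \<Longrightarrow> ab x powr s \<le> b" for s b
    unfolding w_def
  proof (rule num_radius_powr_le)
    fix x :: 'a assume x: "norm x = 1"
    let ?u = "cmod (cinner ((T o\<^sub>L T) x) x)"
    have "cmod (cinner (T x) x) powr (2 * s) = (cmod (cinner (T x) x))\<^sup>2 powr s"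
      by (simp add: powr_powr_half)
    also have "\<dots> \<le> ((ab x + ?u) / 2) powr s"
      unfolding ab_def using \<open>s \<ge> 1\<close> by (intro powr_mono2 cmod_form_sq_le[OF T x]) auto
    also have "\<dots> \<le> (ab x powr s + ?u powr s) / 2"
      using \<open>s \<ge> 1\<close> ab0 by (intro powr_mean_le) auto
    also have "\<dots> \<le> (b + w2 powr s) / 2"
    proof -
      have "?u powr s \<le> w2 powr s"
        unfolding w2_def using \<open>s \<ge> 1\<close> by (intro powr_mono2 cmod_form_le_num_radius[OF x]) auto
      with that(3)[OF x] show ?thesis by simp
    qed
    finally show "cmod (cinner (T x) x) powr (2 * s) \<le> (b + w2 powr s) / 2" .
  qed (use that in auto)
  have w2r: "w2 powr r \<le> F / 2"
    using \<open>1 \<le> r\<close> nonneg by (intro w2_powr abF) auto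
  have w22r: "w2 powr (2 * r) \<le> E / 2"
    using \<open>1 \<le> r\<close> nonneg by (intro w2_powr abE) auto
  have w2F: "w powr (2 * r) \<le> (F / 2 + w2 powr r) / 2"
    using \<open>1 \<le> r\<close> nonneg by (intro w_powr abF) auto
  have M1: "w powr (4 * r) \<le> (E / 4 + v / 2 + w2 powr (2 * r)) / 2"
    using w_powr[of "2 * r", OF _ _ abEv] \<open>1 \<le> r\<close> nonneg by simp
  define M0 where "M0 = (F / 2 + w2 powr r) / 2 * w powr (2 * r)"
  have M0: "w powr (4 * r) \<le> M0"
  proof -
    have "w powr (4 * r) = w powr (2 * r) * w powr (2 * r)"
      by (simp flip: powr_add)
    also have "\<dots> \<le> M0"
      unfolding M0_def by (intro mult_right_mono w2F) simp
    finally show ?thesis .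
  qed
  have M0_le: "M0 \<le> E / 2"
  proof -
    \<comment> \<open>Both factors of \<open>M0\<close> are at most \<open>F / 2\<close>, because
      \<open>w2 powr r\<close> is.\<close>
    have "M0 \<le> F / 2 * (F / 2)"
      unfolding M0_def using w2r w2F nonneg by (intro mult_mono) auto
    also have "\<dots> \<le> E / 2"
      using norm_add_sq_le[OF C D] by (simp add: E_def F_def power2_eq_square)
    finally show ?thesis .
  qed
  let ?M1 = "(E / 4 + v / 2 + w2 powr (2 * r)) / 2"
  let ?M = "\<alpha> / 8 * E + \<alpha> / 4 * v + \<alpha> / 2 * w2 powr (2 * r)
      + (1 - \<alpha>) / 4 * F * w powr (2 * r) + (1 - \<alpha>) / 2 * w2 powr r * w powr (2 * r)"
  \<comment> \<open>The middle expression is affine in \<alpha>, so both inequalities need only its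
    endpoint values \<open>M0\<close> and \<open>?M1\<close>, each of which lies between
    \<open>w powr (4 * r)\<close> and \<open>E / 2\<close>.\<close>
  have M_eq: "?M = \<alpha> * ?M1 + (1 - \<alpha>) * M0"
    by (simp add: M0_def field_simps)
  have "w powr (4 * r) = \<alpha> * w powr (4 * r) + (1 - \<alpha>) * w powr (4 * r)"
    by (simp add: algebra_simps)
  also have "\<dots> \<le> ?M"
    unfolding M_eq using assms(2,3) M1 M0 by (intro add_mono mult_left_mono) auto
  finally have lower: "w powr (4 * r) \<le> ?M" .
  have "?M \<le> \<alpha> * (E / 2) + (1 - \<alpha>) * (E / 2)"
    unfolding M_eq using assms(2,3) v_le w22r M0_le by (intro add_mono mult_left_mono) auto
  also have "\<dots> = 1 / 2 * E"
    by (simp flip: distrib_right)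
  finally have "?M \<le> 1 / 2 * E" .
  with lower show ?thesis
    unfolding Let_def CC DD by (simp only: w_def w2_def v_def E_def F_def C_def D_def simp_thms)
qed

end
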